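(* Let $n\ge 1$ be an integer. If $f_{1},\ldots,f_{n}\in L^{1}([0,1];\mathbb{C})$, then there exists $\theta\in C^{\infty}([0,1];\mathbb{R})$ such that for each $k\in\{1,\ldots,n\}$ $$\int_{0}^{1}f_{k}(t)e^{i\theta(t)}\,dt=0$$ and $\left\Vert e^{i\theta(\cdot)}\right\Vert_{W^{1,1}}\le 5\pi n+1$.
   Context: For a smooth function $g:[0,1]\to\mathbb{C}$, $\|g(\cdot)\|_{W^{1,1}}=\int_{0}^{1}|g(t)|\,dt+\int_{0}^{1}|g'(t)|\,dt$. *)

theory Defs
  imports "HOL-Analysis.Analysis"
begin

text \<open>
  Smoothness on a set. With \<^term>\<open>S = {a..b}\<close> this is the class of infinitely differentiable
  functions on the closed interval, with one-sided derivatives at the endpoints. The witness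
  \<open>D k\<close> is the \<open>k\<close>-th derivative; values of \<open>f\<close> outside \<open>S\<close> are irrelevant.
\<close>
definition smooth_on :: "real set \<Rightarrow> (real \<Rightarrow> 'a::real_normed_vector) \<Rightarrow> bool" where
  "smooth_on S f \<longleftrightarrow>
     (\<exists>D :: nat \<Rightarrow> real \<Rightarrow> 'a.
        (\<forall>t\<in>S. D 0 t = f t) \<and>
        (\<forall>k. \<forall>t\<in>S. (D k has_vector_derivative D (Suc k) t) (at t within S)))"

text \<open>
  This is meant for \<^term>\<open>g\<close> smooth on the unit interval, where both integrands are continuous;
  otherwise the totalised Bochner integral and derivative need not be meaningful.
\<close>
definition W11_norm :: "(real \<Rightarrow> complex) \<Rightarrow> real" where
  "W11_norm g =
     (LINT t:{0..1}|lebesgue. norm (g t)) +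
     (LINT t:{0..1}|lebesgue. norm (vector_derivative g (at t within {0..1})))"

end

theory Submission
  imports Defs "HOL-Library.Z2" "HOL-Computational_Algebra.Polynomial"
begin

text \<open>
  Let \<open>P\<^sub>i\<close> be the real and imaginary parts of the functions \<open>f\<^sub>k\<close>. It suffices to find a smooth
  unimodular \<open>u = a + \<i> b\<close> such that all \<open>P\<^sub>i\<close> have vanishing integrals against both \<open>a\<close> and \<open>b\<close>. A point
  \<open>x\<close> of the octahedral sphere of dimension \<open>r\<close> divides the unit interval into pieces of lengths
  \<open>\<bar>x\<^sub>j\<bar>\<close> with signs. On each piece let \<open>u\<close> start at \<open>\<i>\<close>, rotate quickly to the sign of \<open>x\<^sub>j\<close>, stay there, and
  rotate quickly back to \<open>\<i>\<close>. All pieces begin and end at the same value, so \<open>u\<close> depends continuously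
  on \<open>x\<close> (almost everywhere pointwise) even when pieces degenerate, while every \<open>u\<close> is smooth. Replacing
  \<open>x\<close> by \<open>- x\<close> changes the sign of \<open>a\<close> and leaves \<open>b\<close> unchanged.

  The integrals of \<open>P\<^sub>i a\<close> are thus odd in \<open>x\<close>, and a version of the Borsuk--Ulam theorem
  (\<open>borsuk_ulam_l1\<close>) provides a common zero. The integrals of \<open>P\<^sub>i b\<close> are even but small, because \<open>b\<close> lives
  on the short transition intervals; they are made to vanish beforehand, for every \<open>x\<close>, by a
  small polynomial perturbation of the angle, which is found by a contraction argument and is the
  same for \<open>x\<close> and \<open>- x\<close> (\<open>annihilating_phase_independent\<close>). This needs polynomials dual to the
  \<open>P\<^sub>i\<close>, hence a prior reduction to independent functions (\<open>annihilating_phase\<close>), which leaves \<open>r \<le> 2 n\<close> of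
  them. Each of the \<open>r + 1\<close> pieces costs two rotations by a quarter turn, in total at most
  \<open>(2 n + 1) \<pi>\<close> up to the perturbation, and this leaves ample room below \<open>5 \<pi> n\<close>.

  The Borsuk--Ulam theorem is proved through Tucker's lemma (\<open>tucker_l1_sphere\<close>). The usual count of
  alternating simplices is phrased with cochains modulo 2 on lists of vertices, where it becomes
  the identity \<open>cobd_alternating\<close>; barycentric subdivision commutes with the coboundary and makes the
  simplices small.
\<close>

section \<open>Cochains modulo 2 on lists of vertices\<close>

text \<open>
  A simplex is a list of vertices and a cochain is a function from such lists to the field with
  two elements. Formal simplices suffice below: no embedding, orientation or injectivity is needed.
\<close>

lemma bit_self: "(a::bit) + a = 0" by (cases a) auto
lemma bit_self_left: "(a::bit) + (a + b) = b" by (cases a; cases b) auto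

(* Sums of bits are kept as sums, so that the laws of commutative groups apply. *)
declare add_bit_eq_xor [simp del]

text \<open>
  The coboundary modulo 2: the sum of the values of \<open>\<phi>\<close> on all facets of a simplex, that is, on the
  lists with one entry deleted. The complex is augmented: a single vertex has the empty list as
  its facet.
\<close>
primrec cobd :: "('a list \<Rightarrow> bit) \<Rightarrow> 'a list \<Rightarrow> bit" where
  "cobd \<phi> [] = 0"
| "cobd \<phi> (x # xs) = \<phi> xs + cobd (\<lambda>l. \<phi> (x # l)) xs"

lemma cobd_add: "cobd (\<lambda>l. \<phi> l + \<psi> l) vs = cobd \<phi> vs + cobd \<psi> vs"
  by (induction vs arbitrary: \<phi> \<psi>) (auto simp: ac_simps)

lemma cobd_zero: "cobd (\<lambda>l. 0) vs = 0"
  by (induction vs) auto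

lemma cobd_cobd: "cobd (cobd \<phi>) vs = 0"
  by (induction vs arbitrary: \<phi>) (auto simp: cobd_add bit_self_left)

lemma cobd_map: "cobd \<phi> (map g vs) = cobd (\<lambda>l. \<phi> (map g l)) vs"
  by (induction vs arbitrary: \<phi>) auto

lemma cobd_cong:
  assumes "\<And>l. Suc (length l) = length vs \<Longrightarrow> set l \<subseteq> set vs \<Longrightarrow> \<phi> l = \<psi> l"
  shows "cobd \<phi> vs = cobd \<psi> vs"
  using assms
proof (induction vs arbitrary: \<phi> \<psi>)
  case (Cons x xs)
  have "cobd (\<lambda>l. \<phi> (x # l)) xs = cobd (\<lambda>l. \<psi> (x # l)) xs"
    by (rule Cons.IH, rule Cons.prems) auto
  then show ?case using Cons.prems[of xs] by auto
qed auto

text \<open>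
  The coboundary of a cochain that first sorts its argument by a key is obtained by sorting first.
  Ties are harmless because insertion sort is stable and deleting an entry preserves the order.
\<close>
lemma cobd_insort_key:
  assumes "sorted (map f ys)"
  shows "cobd \<phi> (insort_key f x ys) = \<phi> ys + cobd (\<lambda>l. \<phi> (insort_key f x l)) ys"
  using assms
proof (induction ys arbitrary: \<phi>)
  case (Cons y ys)
  show ?case
  proof (cases "f x \<le> f y")
    case True
    have "cobd (\<lambda>l. \<phi> (insort_key f x l)) (y # ys) = cobd (\<lambda>l. \<phi> (x # l)) (y # ys)"
    proof (rule cobd_cong)
      fix l assume l: "set l \<subseteq> set (y # ys)"
      have "insort_key f x l = x # l"
        using Cons.prems True l by (cases l) auto
      then show "\<phi> (insort_key f x l) = \<phi> (x # l)" by simp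
    qed
    then show ?thesis using True by simp
  next
    case False
    then show ?thesis using Cons by (simp add: ac_simps)
  qed
qed auto

lemma cobd_sort_key: "cobd (\<lambda>l. \<phi> (sort_key f l)) vs = cobd \<phi> (sort_key f vs)"
proof (induction vs arbitrary: \<phi>)
  case (Cons x xs)
  then show ?case
    by (simp add: cobd_insort_key Cons.IH[of "\<lambda>l. \<phi> (insort_key f x l)"])
qed auto

text \<open>
  The cochain that recognises strictly alternating sign patterns whose first sign is \<open>s\<close>.
\<close>
primrec alternating :: "bool \<Rightarrow> bool list \<Rightarrow> bit" where
  "alternating s [] = 1"
| "alternating s (x # xs) = (if x = s then alternating (\<not> s) xs else 0)"

text \<open>
  The combinatorial core of the lemmas of Fan and Tucker: the number of facets of a nonempty sign
  pattern that alternate starting with \<open>s\<close> is odd exactly when the pattern itself alternates.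
\<close>
lemma cobd_alternating: "cobd (alternating s) l = alternating True l + alternating False l"
proof (induction l arbitrary: s)
  case (Cons x xs)
  show ?case
  proof (cases "x = s")
    case True
    then have "cobd (\<lambda>l. alternating s (x # l)) xs = alternating True xs + alternating False xs"
      using Cons[of "\<not> s"] by simp
    then show ?thesis using True by (cases s) (auto simp: bit_self_left ac_simps)
  next
    case False
    then have "cobd (\<lambda>l. alternating s (x # l)) xs = 0" by (simp add: cobd_zero)
    then show ?thesis using False by (cases s) auto
  qed
qed (auto simp: bit_self)

lemma alternating_map_Not: "alternating s (map Not l) = alternating (\<not> s) l"
  by (induction l arbitrary: s) auto

text \<open>
  Vertices carry a label \<open>lab v\<close> and a sign \<open>sg v\<close>. The cochain \<open>fan lab sg s\<close> recognises the simplices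
  whose signs alternate, starting with \<open>s\<close>, when the vertices are arranged by increasing label.
\<close>
definition fan :: "('a \<Rightarrow> nat) \<Rightarrow> ('a \<Rightarrow> bool) \<Rightarrow> bool \<Rightarrow> 'a list \<Rightarrow> bit" where
  "fan lab sg s vs = alternating s (map sg (sort_key lab vs))"

lemma cobd_fan: "cobd (fan lab sg s) vs = fan lab sg True vs + fan lab sg False vs"
proof -
  have "cobd (fan lab sg s) vs = cobd (alternating s) (map sg (sort_key lab vs))"
    unfolding fan_def by (simp add: cobd_map cobd_sort_key[of "\<lambda>l. alternating s (map sg l)"])
  then show ?thesis by (simp add: cobd_alternating fan_def)
qed

lemma sort_key_map: "sort_key f (map g vs) = map g (sort_key (f \<circ> g) vs)"
proof -
  have "insort_key f (g x) (map g ys) = map g (insort_key (f \<circ> g) x ys)" for x ys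
    by (induction ys) auto
  then show ?thesis by (induction vs) auto
qed

lemma sort_key_cong_on:
  assumes "\<And>v. v \<in> set vs \<Longrightarrow> f v = g v"
  shows "sort_key f vs = sort_key g vs"
proof -
  have "insort_key f x ys = insort_key g x ys" if "\<And>v. v \<in> set (x # ys) \<Longrightarrow> f v = g v" for x ys
    using that by (induction ys) auto
  note ins = this
  show ?thesis using assms
  proof (induction vs)
    case (Cons a vs)
    then show ?case using ins[of a "sort_key g vs"] by simp
  qed simp
qed

lemma fan_antipodal:
  assumes "\<And>v. v \<in> set vs \<Longrightarrow> lab (g v) = lab v" "\<And>v. v \<in> set vs \<Longrightarrow> sg (g v) = (\<not> sg v)"
  shows "fan lab sg s (map g vs) = fan lab sg (\<not> s) vs"
proof -
  have "sort_key (lab \<circ> g) vs = sort_key lab vs"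
    using assms(1) by (intro sort_key_cong_on) auto
  moreover have "map sg (map g (sort_key lab vs)) = map Not (map sg (sort_key lab vs))"
    using assms(2) by auto
  ultimately show ?thesis
    unfolding fan_def by (simp only: sort_key_map alternating_map_Not)
qed

text \<open>
  If two vertices share a label, then the sorted list has two neighbours with equal labels, and
  alternation forces their signs to be opposite.
\<close>
lemma fan_nonzero:
  assumes "fan lab sg s vs \<noteq> 0" "\<not> distinct (map lab vs)"
  obtains u w where "u \<in> set vs" "w \<in> set vs" "lab u = lab w" "sg u" "\<not> sg w"
proof -
  define ws where "ws = sort_key lab vs"
  have alt: "sg (ws ! Suc i) = (\<not> sg (ws ! i))" if "Suc i < length ws" for i
  proof -
    have "alternating s bs \<noteq> 0 \<Longrightarrow> Suc i < length bs \<Longrightarrow> bs ! Suc i = (\<not> bs ! i)" for bs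
    proof (induction bs arbitrary: s i)
      case (Cons b bs)
      then show ?case
        by (cases i; cases bs) (auto split: if_splits)
    qed auto
    from this[of "map sg ws"] show ?thesis using assms(1) that by (auto simp: fan_def ws_def)
  qed
  have "\<not> distinct (map lab ws)"
    using assms(2) by (auto simp: ws_def distinct_map)
  then obtain i j where ij: "i < j" "j < length ws" "lab (ws ! i) = lab (ws ! j)"
    by (auto simp: distinct_conv_nth) (metis linorder_neqE_nat)
  have srt: "sorted (map lab ws)" by (simp add: ws_def)
  have "lab (ws ! i) = lab (ws ! Suc i)"
    using ij sorted_nth_mono[OF srt, of i "Suc i"] sorted_nth_mono[OF srt, of "Suc i" j] by auto
  moreover have "ws ! i \<in> set vs" "ws ! Suc i \<in> set vs"
    using ij by (metis Suc_lessI nth_mem order_less_trans set_sort ws_def)+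
  moreover have "Suc i < length ws" using ij by auto
  ultimately show ?thesis using alt[of i] that[of "ws ! i" "ws ! Suc i"] that[of "ws ! Suc i" "ws ! i"]
    by (cases "sg (ws ! i)") auto
qed

section \<open>Barycentric subdivision\<close>

text \<open>
  The pullback of cochains along barycentric subdivision, with \<open>b\<close> assigning a barycentre to each
  simplex: \<open>\<phi>\<close> is summed over all pieces, each of which is the barycentre of \<open>vs\<close> followed by a piece
  of the subdivision of a facet. The counter in \<open>subdiv_aux\<close> is the number of vertices.
\<close>
primrec subdiv_aux :: "('a list \<Rightarrow> 'a) \<Rightarrow> nat \<Rightarrow> ('a list \<Rightarrow> bit) \<Rightarrow> 'a list \<Rightarrow> bit" where
  "subdiv_aux b 0 \<phi> vs = \<phi> []"
| "subdiv_aux b (Suc n) \<phi> vs = cobd (\<lambda>\<rho>. subdiv_aux b n (\<lambda>\<tau>. \<phi> (b vs # \<tau>)) \<rho>) vs"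

definition subdiv :: "('a list \<Rightarrow> 'a) \<Rightarrow> ('a list \<Rightarrow> bit) \<Rightarrow> 'a list \<Rightarrow> bit" where
  "subdiv b \<phi> vs = subdiv_aux b (length vs) \<phi> vs"

lemma subdiv_aux_add: "subdiv_aux b n (\<lambda>l. \<phi> l + \<psi> l) vs = subdiv_aux b n \<phi> vs + subdiv_aux b n \<psi> vs"
  by (induction n arbitrary: \<phi> \<psi> vs) (auto simp: cobd_add)

lemma subdiv_aux_cobd:
  "length vs = Suc n \<Longrightarrow> subdiv_aux b (Suc n) (cobd \<phi>) vs = cobd (subdiv_aux b n \<phi>) vs"
proof (induction n arbitrary: \<phi> vs)
  case 0
  then obtain v where "vs = [v]" by (auto simp: length_Suc_conv)
  then show ?case by simp
next
  case (Suc n)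
  let ?\<phi> = "\<lambda>l. \<phi> (b vs # l)"
  have "subdiv_aux b (Suc (Suc n)) (cobd \<phi>) vs
      = cobd (\<lambda>\<rho>. subdiv_aux b (Suc n) \<phi> \<rho> + subdiv_aux b (Suc n) (cobd ?\<phi>) \<rho>) vs"
    unfolding subdiv_aux.simps(2)[of b "Suc n" "cobd \<phi>"] cobd.simps(2) subdiv_aux_add ..
  also have "\<dots> = cobd (subdiv_aux b (Suc n) \<phi>) vs + cobd (\<lambda>\<rho>. subdiv_aux b (Suc n) (cobd ?\<phi>) \<rho>) vs"
    by (simp only: cobd_add)
  also have "cobd (\<lambda>\<rho>. subdiv_aux b (Suc n) (cobd ?\<phi>) \<rho>) vs = cobd (cobd (subdiv_aux b n ?\<phi>)) vs"
    by (intro cobd_cong Suc.IH) (use Suc.prems in auto)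
  finally show ?case by (simp add: cobd_cobd)
qed

lemma subdiv_cobd: "subdiv b (cobd \<phi>) = cobd (subdiv b \<phi>)"
proof
  fix vs :: "'a list"
  show "subdiv b (cobd \<phi>) vs = cobd (subdiv b \<phi>) vs"
  proof (cases vs)
    case Nil then show ?thesis by (simp add: subdiv_def)
  next
    case (Cons v ws)
    then have "subdiv b (cobd \<phi>) vs = cobd (subdiv_aux b (length ws) \<phi>) vs"
      by (simp add: subdiv_def del: subdiv_aux.simps cobd.simps add: subdiv_aux_cobd)
    also have "\<dots> = cobd (subdiv b \<phi>) vs"
      by (intro cobd_cong) (auto simp: Cons subdiv_def)
    finally show ?thesis .
  qed
qed

lemma subdiv_add: "subdiv b (\<lambda>l. \<phi> l + \<psi> l) = (\<lambda>l. subdiv b \<phi> l + subdiv b \<psi> l)"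
  by (rule ext) (simp add: subdiv_def subdiv_aux_add)

lemma subdiv_iter_cobd: "(subdiv b ^^ N) (cobd \<phi>) = cobd ((subdiv b ^^ N) \<phi>)"
  by (induction N) (auto simp: subdiv_cobd)

lemma subdiv_iter_add:
  "(subdiv b ^^ N) (\<lambda>l. \<phi> l + \<psi> l) = (\<lambda>l. (subdiv b ^^ N) \<phi> l + (subdiv b ^^ N) \<psi> l)"
  by (induction N) (auto simp: subdiv_add)

lemma subdiv_map:
  assumes "\<And>l. b (map g l) = g (b l)"
  shows "subdiv b \<phi> (map g vs) = subdiv b (\<lambda>l. \<phi> (map g l)) vs"
proof -
  have "subdiv_aux b n \<phi> (map g vs) = subdiv_aux b n (\<lambda>l. \<phi> (map g l)) vs" for n
    by (induction n arbitrary: \<phi> vs) (auto simp: cobd_map assms)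
  then show ?thesis by (simp add: subdiv_def)
qed

lemma subdiv_iter_map:
  assumes "\<And>l. b (map g l) = g (b l)"
  shows "(subdiv b ^^ N) \<phi> (map g vs) = (subdiv b ^^ N) (\<lambda>l. \<phi> (map g l)) vs"
proof (induction N arbitrary: vs)
  case (Suc N)
  have "(subdiv b ^^ Suc N) \<phi> (map g vs) = subdiv b (\<lambda>l. (subdiv b ^^ N) \<phi> (map g l)) vs"
    by (simp add: subdiv_map[where b = b and g = g, OF assms])
  also have "\<dots> = subdiv b ((subdiv b ^^ N) (\<lambda>l. \<phi> (map g l))) vs"
    using Suc by presburger
  finally show ?case by simp
qed auto

section \<open>The boundary of the cross-polytope\<close>

text \<open>
  The value of a cochain on the cycle of all facets of the \<open>k\<close>-dimensional cross-polytope, whose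
  vertices are \<open>e i\<close> and their antipodes \<open>g (e i)\<close> for \<open>i < k\<close>.
\<close>
primrec octa :: "(nat \<Rightarrow> 'a) \<Rightarrow> ('a \<Rightarrow> 'a) \<Rightarrow> nat \<Rightarrow> ('a list \<Rightarrow> bit) \<Rightarrow> bit" where
  "octa e g 0 \<phi> = \<phi> []"
| "octa e g (Suc k) \<phi> = octa e g k (\<lambda>l. \<phi> (e k # l)) + octa e g k (\<lambda>l. \<phi> (g (e k) # l))"

lemma octa_add: "octa e g k (\<lambda>l. \<phi> l + \<psi> l) = octa e g k \<phi> + octa e g k \<psi>"
  by (induction k arbitrary: \<phi> \<psi>) (auto simp: ac_simps)

lemma octa_cobd: "octa e g k (cobd \<phi>) = 0"
  by (induction k arbitrary: \<phi>) (auto simp: octa_add bit_self)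

lemma octa_antipodal:
  assumes "\<And>v. g (g v) = v"
  shows "octa e g k (\<lambda>l. \<phi> (map g l)) = octa e g k \<phi>"
proof (induction k arbitrary: \<phi>)
  case (Suc k)
  show ?case
    using Suc[of "\<lambda>l. \<phi> (e k # l)"] Suc[of "\<lambda>l. \<phi> (g (e k) # l)"] by (simp add: assms add.commute)
qed auto

text \<open>
  The facet of the cross-polytope with the signs \<open>s\<close>, listed with decreasing index.
\<close>
definition octa_facet :: "(nat \<Rightarrow> 'a) \<Rightarrow> ('a \<Rightarrow> 'a) \<Rightarrow> (nat \<Rightarrow> bool) \<Rightarrow> nat \<Rightarrow> 'a list" where
  "octa_facet e g s k = map (\<lambda>i. if s i then e i else g (e i)) (rev [0..<k])"

lemma octa_cong:
  assumes "\<And>s. \<phi> (octa_facet e g s k) = \<psi> (octa_facet e g s k)"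
  shows "octa e g k \<phi> = octa e g k \<psi>"
  using assms
proof (induction k arbitrary: \<phi> \<psi>)
  case (Suc k)
  have *: "octa_facet e g (s(k := c)) (Suc k) = (if c then e k else g (e k)) # octa_facet e g s k" for s c
    by (auto simp: octa_facet_def)
  have "octa e g k (\<lambda>l. \<phi> (e k # l)) = octa e g k (\<lambda>l. \<psi> (e k # l))"
    proof (rule Suc.IH)
    fix s show "\<phi> (e k # octa_facet e g s k) = \<psi> (e k # octa_facet e g s k)"
      using Suc.prems[of "s(k := True)"] unfolding * by simp
  qed
  moreover have "octa e g k (\<lambda>l. \<phi> (g (e k) # l)) = octa e g k (\<lambda>l. \<psi> (g (e k) # l))"
    proof (rule Suc.IH)
    fix s show "\<phi> (g (e k) # octa_facet e g s k) = \<psi> (g (e k) # octa_facet e g s k)"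
      using Suc.prems[of "s(k := False)"] unfolding * by simp
  qed
  ultimately show ?case by simp
qed (simp add: octa_facet_def)

text \<open>
  A cochain \<open>\<psi>\<close> whose coboundary is \<open>\<psi>\<close> plus its antipodal image takes the value 1 on every
  cross-polytope cycle. Induction step: the cycle is a hemisphere plus its antipodal image, so \<open>\<psi>\<close>
  on the cycle is the coboundary of \<open>\<psi>\<close> on the hemisphere, which is \<open>\<psi>\<close> on the equator.
\<close>
lemma octa_eq_1:
  assumes "\<And>v. g (g v) = v" and "\<psi> [] = 1"
    and cobd: "\<And>s k. k \<le> m \<Longrightarrow>
      cobd \<psi> (octa_facet e g s k) = \<psi> (octa_facet e g s k) + \<psi> (map g (octa_facet e g s k))"
  shows "k \<le> m \<Longrightarrow> octa e g k \<psi> = 1"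
proof (induction k)
  case (Suc k)
  have "octa e g (Suc k) \<psi> = octa e g k (\<lambda>l. \<psi> (e k # l)) + octa e g k (\<lambda>l. \<psi> (g (e k) # map g l))"
    using octa_antipodal[OF assms(1), of e k "\<lambda>l. \<psi> (g (e k) # l)"] by simp
  also have "\<dots> = octa e g k (\<lambda>l. \<psi> (e k # l) + \<psi> (map g (e k # l)))"
    by (simp only: octa_add list.map)
  also have "\<dots> = octa e g k (\<lambda>l. cobd \<psi> (e k # l))"
  proof (rule octa_cong)
    fix s
    have "octa_facet e g (s(k := True)) (Suc k) = e k # octa_facet e g s k"
      by (auto simp: octa_facet_def)
    then show "\<psi> (e k # octa_facet e g s k) + \<psi> (map g (e k # octa_facet e g s k))
        = cobd \<psi> (e k # octa_facet e g s k)"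
      using cobd[of "Suc k" "s(k := True)"] Suc.prems by simp
  qed
  also have "\<dots> = octa e g k \<psi>"
    by (simp add: octa_add octa_cobd)
  finally show ?case using Suc by simp
qed (use assms in auto)

text \<open>
  \<open>flag b vs \<tau>\<close> says that \<open>\<tau>\<close> is a piece of the barycentric subdivision of \<open>vs\<close>.
\<close>
inductive flag :: "('a list \<Rightarrow> 'a) \<Rightarrow> 'a list \<Rightarrow> 'a list \<Rightarrow> bool" for b where
  flag_Nil: "flag b [] []"
| flag_Cons: "Suc (length \<rho>) = length vs \<Longrightarrow> set \<rho> \<subseteq> set vs \<Longrightarrow> flag b \<rho> \<tau> \<Longrightarrow> flag b vs (b vs # \<tau>)"

lemma subdiv_cong:
  assumes "\<And>\<tau>. flag b vs \<tau> \<Longrightarrow> \<phi> \<tau> = \<psi> \<tau>"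
  shows "subdiv b \<phi> vs = subdiv b \<psi> vs"
proof -
  have "subdiv_aux b n \<phi> vs = subdiv_aux b n \<psi> vs"
    if "length vs = n" "\<And>\<tau>. flag b vs \<tau> \<Longrightarrow> \<phi> \<tau> = \<psi> \<tau>" for n \<phi> \<psi> vs
    using that
  proof (induction n arbitrary: \<phi> \<psi> vs)
    case 0
    then show ?case by (simp add: flag_Nil)
  next
    case (Suc n)
    show ?case unfolding subdiv_aux.simps
    proof (rule cobd_cong)
      fix \<rho> assume \<rho>: "Suc (length \<rho>) = length vs" "set \<rho> \<subseteq> set vs"
      show "subdiv_aux b n (\<lambda>\<tau>. \<phi> (b vs # \<tau>)) \<rho> = subdiv_aux b n (\<lambda>\<tau>. \<psi> (b vs # \<tau>)) \<rho>"
      proof (rule Suc.IH)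
        show "length \<rho> = n" using \<rho>(1) Suc.prems(1) by simp
        show "\<phi> (b vs # \<tau>) = \<psi> (b vs # \<tau>)" if "flag b \<rho> \<tau>" for \<tau>
          using Suc.prems(2) flag_Cons[OF \<rho> that] .
      qed
    qed
  qed
  from this[OF refl assms] show ?thesis by (simp add: subdiv_def)
qed

section \<open>Mesh size of iterated subdivisions\<close>

text \<open>
  Points are real sequences. The centroid is taken coordinatewise.
\<close>
definition centroid :: "(nat \<Rightarrow> real) list \<Rightarrow> nat \<Rightarrow> real" where
  "centroid vs = (\<lambda>i. (\<Sum>v\<leftarrow>vs. v i) / real (length vs))"

text \<open>
  The vertices of \<open>vs\<close> differ by at most \<open>d\<close> in every coordinate.
\<close>
definition mesh_le :: "real \<Rightarrow> (nat \<Rightarrow> real) list \<Rightarrow> bool" where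
  "mesh_le d vs \<longleftrightarrow> (\<forall>u\<in>set vs. \<forall>w\<in>set vs. \<forall>i. \<bar>u i - w i\<bar> \<le> d)"

text \<open>
  A set that contains the centroids of its nonempty finite families; this is all that is used of convexity.
\<close>
definition centroid_closed :: "(nat \<Rightarrow> real) set \<Rightarrow> bool" where
  "centroid_closed K \<longleftrightarrow> (\<forall>l. l \<noteq> [] \<longrightarrow> set l \<subseteq> K \<longrightarrow> centroid l \<in> K)"

lemma flag_subset:
  assumes "flag centroid vs \<tau>" "set vs \<subseteq> K" "centroid_closed K"
  shows "set \<tau> \<subseteq> K"
  using assms
proof induction
  case (flag_Cons \<rho> vs \<tau>)
  then have "vs \<noteq> []" by auto
  then show ?case using flag_Cons by (auto simp: centroid_closed_def)
qed simp

lemma flag_length: "flag b vs \<tau> \<Longrightarrow> length \<tau> = length vs"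
  by (induction rule: flag.induct) auto

lemma abs_sum_list_le:
  fixes f :: "'a \<Rightarrow> real"
  shows "(\<And>v. v \<in> set l \<Longrightarrow> \<bar>f v\<bar> \<le> d) \<Longrightarrow> \<bar>\<Sum>v\<leftarrow>l. f v\<bar> \<le> real (length l) * d"
proof (induction l)
  case (Cons a l)
  have "\<bar>f a\<bar> \<le> d" "\<bar>\<Sum>v\<leftarrow>l. f v\<bar> \<le> real (length l) * d" using Cons by auto
  then show ?case using abs_triangle_ineq[of "f a" "\<Sum>v\<leftarrow>l. f v"] by (simp add: algebra_simps)
qed simp

lemma centroid_diff:
  assumes "l \<noteq> []"
  shows "centroid l i - c = (\<Sum>v\<leftarrow>l. v i - c) / real (length l)"
  using assms by (simp add: centroid_def field_simps sum_list_subtractf sum_list_triv)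

lemma centroid_closed_box: "centroid_closed {w. \<forall>i. \<bar>w i - c i\<bar> \<le> d}"
  unfolding centroid_closed_def
proof (intro allI impI CollectI)
  fix l i assume l: "l \<noteq> []" "set l \<subseteq> {w. \<forall>i. \<bar>w i - c i\<bar> \<le> d}"
  have "\<bar>\<Sum>v\<leftarrow>l. v i - c i\<bar> \<le> real (length l) * d"
    by (rule abs_sum_list_le) (use l in auto)
  then show "\<bar>centroid l i - c i\<bar> \<le> d"
    using l(1) by (simp add: centroid_diff field_simps)
qed

lemma centroid_near:
  assumes "mesh_le d l" "v \<in> set l" "0 \<le> d" "length l \<le> L"
  shows "\<bar>v i - centroid l i\<bar> \<le> (1 - 1 / real L) * d"
proof -
  have ne: "l \<noteq> []" using assms(2) by auto
  from assms(2) obtain l1 l2 where l: "l = l1 @ v # l2" by (auto simp: in_set_conv_decomp)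
  have "(\<Sum>w\<leftarrow>l. w i - v i) = (\<Sum>w\<leftarrow>l1 @ l2. w i - v i)" by (simp add: l)
  also have "\<bar>\<dots>\<bar> \<le> real (length (l1 @ l2)) * d"
    by (rule abs_sum_list_le) (use assms(1,2) in \<open>auto simp: mesh_le_def l\<close>)
  finally have "\<bar>centroid l i - v i\<bar> \<le> (real (length l) - 1) * d / real (length l)"
    using ne by (simp add: centroid_diff l divide_right_mono)
  also have "\<dots> = (1 - 1 / real (length l)) * d"
    using ne by (simp add: field_simps)
  also have "\<dots> \<le> (1 - 1 / real L) * d"
    using assms ne by (intro mult_right_mono) (auto simp: frac_le)
  finally show ?thesis by (simp add: abs_minus_commute)
qed

lemma flag_mesh:
  assumes "flag centroid vs \<tau>" "mesh_le d vs" "0 \<le> d" "length vs \<le> L"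
  shows "mesh_le ((1 - 1 / real L) * d) \<tau>"
  using assms
proof induction
  case flag_Nil
  then show ?case by (simp add: mesh_le_def)
next
  case (flag_Cons \<rho> vs \<tau>)
  let ?d = "(1 - 1 / real L) * d"
  have 1: "mesh_le ?d \<tau>"
  proof (rule flag_Cons.IH)
    show "mesh_le d \<rho>" using flag_Cons.prems(1) flag_Cons.hyps(2) unfolding mesh_le_def by blast
  qed (use flag_Cons.prems flag_Cons.hyps(1) in auto)
  have 2: "set \<tau> \<subseteq> {w. \<forall>i. \<bar>w i - centroid vs i\<bar> \<le> ?d}"
    by (rule flag_subset[OF flag_Cons.hyps(3) _ centroid_closed_box])
       (use flag_Cons centroid_near[of d vs _ L] in auto)
  have 0: "0 \<le> ?d" using flag_Cons.prems by (cases L) auto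
  show ?case unfolding mesh_le_def
  proof (intro ballI allI)
    fix u w i assume uw: "u \<in> set (centroid vs # \<tau>)" "w \<in> set (centroid vs # \<tau>)"
    have *: "\<bar>v i - centroid vs i\<bar> \<le> ?d" if "v \<in> set \<tau>" for v using 2 that by blast
    consider "u \<in> set \<tau>" "w \<in> set \<tau>" | "u \<in> set \<tau>" "w = centroid vs" | "u = centroid vs" "w \<in> set \<tau>"
      | "u = centroid vs" "w = centroid vs" using uw by auto
    then show "\<bar>u i - w i\<bar> \<le> ?d"
    proof cases
      case 1
      then show ?thesis using \<open>mesh_le ?d \<tau>\<close> unfolding mesh_le_def by blast
    next
      case 2
      then show ?thesis using *[of u] by simp
    next
      case 3
      then show ?thesis using *[of w] abs_minus_commute[of "w i"] by simp
    next
      case 4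
      then show ?thesis using 0 by simp
    qed
  qed
qed

text \<open>
  The \<open>N\<close>-th iterated subdivision of a simplex with \<open>L\<close> vertices only sees simplices with \<open>L\<close> vertices
  whose mesh has shrunk by the factor \<open>(1 - 1 / L) ^ N\<close>.
\<close>
lemma subdiv_iter_cong:
  assumes "set vs \<subseteq> K" "centroid_closed K" "mesh_le d vs" "0 \<le> d" "length vs = L"
    and "\<And>\<tau>. set \<tau> \<subseteq> K \<Longrightarrow> length \<tau> = L \<Longrightarrow> mesh_le ((1 - 1 / real L) ^ N * d) \<tau> \<Longrightarrow> \<phi> \<tau> = \<psi> \<tau>"
  shows "(subdiv centroid ^^ N) \<phi> vs = (subdiv centroid ^^ N) \<psi> vs"
  using assms
proof (induction N arbitrary: vs d)
  case (Suc N)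
  have "subdiv centroid ((subdiv centroid ^^ N) \<phi>) vs = subdiv centroid ((subdiv centroid ^^ N) \<psi>) vs"
  proof (rule subdiv_cong)
    fix \<tau> assume \<tau>: "flag centroid vs \<tau>"
    show "(subdiv centroid ^^ N) \<phi> \<tau> = (subdiv centroid ^^ N) \<psi> \<tau>"
    proof (rule Suc.IH)
      show "mesh_le ((1 - 1 / real L) * d) \<tau>" using flag_mesh[OF \<tau>] Suc.prems by auto
      show "0 \<le> (1 - 1 / real L) * d" using Suc.prems by (cases L) auto
      show "set \<tau> \<subseteq> K" using flag_subset[OF \<tau> Suc.prems(1,2)] .
      show "length \<tau> = L" using flag_length[OF \<tau>] Suc.prems by simp
      show "\<phi> \<sigma> = \<psi> \<sigma>"
        if "set \<sigma> \<subseteq> K" "length \<sigma> = L" "mesh_le ((1 - 1 / real L) ^ N * ((1 - 1 / real L) * d)) \<sigma>" for \<sigma>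
      proof (rule Suc.prems(6))
        have "(1 - 1 / real L) ^ Suc N * d = (1 - 1 / real L) ^ N * ((1 - 1 / real L) * d)"
          by (simp only: power_Suc2 mult.assoc)
        then show "mesh_le ((1 - 1 / real L) ^ Suc N * d) \<sigma>" using that(3) by (simp only:)
      qed (use that in auto)
    qed (fact Suc.prems)
  qed
  then show ?case by simp
qed auto

section \<open>The Borsuk--Ulam theorem on the octahedral sphere\<close>

text \<open>
  The \<open>r\<close>-dimensional unit sphere of the sum norm, on the coordinates \<open>0, \<dots>, r\<close>. It is the boundary of
  the cross-polytope, hence subdivision stays inside it without any normalisation. Moreover the
  absolute values of the coordinates of a point are the lengths of a partition of the unit
  interval into \<open>r + 1\<close> pieces.
\<close>
definition l1_sphere :: "nat \<Rightarrow> (nat \<Rightarrow> real) set" where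
  "l1_sphere r = {x. (\<forall>i>r. x i = 0) \<and> (\<Sum>i\<le>r. \<bar>x i\<bar>) = 1}"

text \<open>
  The part of the sphere in the closed orthant with the signs \<open>s\<close>.
\<close>
definition l1_face :: "nat \<Rightarrow> (nat \<Rightarrow> bool) \<Rightarrow> (nat \<Rightarrow> real) set" where
  "l1_face r s = {x \<in> l1_sphere r. \<forall>i. \<bar>x i\<bar> = (if s i then x i else - x i)}"

lemma abs_le_1_l1_sphere:
  assumes "x \<in> l1_sphere r"
  shows "\<bar>x i\<bar> \<le> 1"
proof (cases "i \<le> r")
  case True
  then have "\<bar>x i\<bar> \<le> (\<Sum>i\<le>r. \<bar>x i\<bar>)" by (intro member_le_sum) auto
  then show ?thesis using assms by (simp add: l1_sphere_def)
qed (use assms in \<open>auto simp: l1_sphere_def\<close>)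

lemma sum_sum_list_commute: "(\<Sum>i\<in>A. \<Sum>v\<leftarrow>l. f v i) = (\<Sum>v\<leftarrow>l. \<Sum>i\<in>A. f v i)" for f :: "'a \<Rightarrow> 'b \<Rightarrow> real"
  by (induction l) (auto simp: sum.distrib)

lemma sum_list_minus: "(\<Sum>v\<leftarrow>l. - f v) = - (\<Sum>v\<leftarrow>l. f v)" for f :: "'a \<Rightarrow> real"
  by (induction l) auto

lemma centroid_closed_l1_face: "centroid_closed (l1_face r s)"
  unfolding centroid_closed_def
proof (intro allI impI)
  fix l assume l: "l \<noteq> []" "set l \<subseteq> l1_face r s"
  define c where "c i = (if s i then 1 else - 1 :: real)" for i
  have abs: "\<bar>v i\<bar> = c i * v i" "0 \<le> c i * v i" if "v \<in> set l" for v i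
  proof -
    have "\<bar>v i\<bar> = (if s i then v i else - v i)" using l(2) that by (auto simp: l1_face_def)
    then show "\<bar>v i\<bar> = c i * v i" "0 \<le> c i * v i"
      using abs_ge_zero[of "v i"] by (auto simp: c_def)
  qed
  have 0: "(\<Sum>v\<leftarrow>l. c i * v i) \<ge> 0" for i
    by (rule sum_list_nonneg) (use abs in auto)
  have c: "\<bar>centroid l i\<bar> = c i * centroid l i" "centroid l i * c i = (\<Sum>v\<leftarrow>l. c i * v i) / length l" for i
    using 0[of i] l(1) by (auto simp: centroid_def c_def sum_list_minus divide_simps split: if_splits)
  have "(\<Sum>i\<le>r. \<bar>centroid l i\<bar>) = (\<Sum>i\<le>r. (\<Sum>v\<leftarrow>l. c i * v i) / length l)"
    using c by (simp add: mult.commute)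
  also have "\<dots> = (\<Sum>v\<leftarrow>l. \<Sum>i\<le>r. c i * v i) / length l"
    by (simp add: sum_divide_distrib[symmetric] sum_sum_list_commute)
  also have "(\<Sum>v\<leftarrow>l. \<Sum>i\<le>r. c i * v i) = (\<Sum>v\<leftarrow>l. 1)"
    by (rule arg_cong[where f = sum_list], rule map_cong) (use l abs in \<open>auto simp: l1_face_def l1_sphere_def\<close>)
  finally have "(\<Sum>i\<le>r. \<bar>centroid l i\<bar>) = 1" using l by (simp add: sum_list_triv)
  moreover have "centroid l i = 0" if "i > r" for i
  proof -
    have "map (\<lambda>v. v i) l = map (\<lambda>v. 0) l" using that l by (auto simp: l1_face_def l1_sphere_def)
    then have "(\<Sum>v\<leftarrow>l. v i) = (\<Sum>v\<leftarrow>l. 0)" by (rule arg_cong)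
    then show ?thesis by (simp add: centroid_def)
  qed
  ultimately show "centroid l \<in> l1_face r s"
    using c by (auto simp: l1_face_def l1_sphere_def c_def)
qed

text \<open>
  Tucker's lemma: an antipodal labelling with only \<open>r\<close> labels on the \<open>r\<close>-dimensional sphere gives equal
  labels and opposite signs to two arbitrarily close points. Indeed the subdivided cochain \<open>fan\<close> has
  value 1 on the whole sphere, so some small simplex with \<open>r + 1\<close> vertices alternates, although two
  of its vertices share a label.
\<close>
lemma tucker_l1_sphere:
  fixes lab :: "(nat \<Rightarrow> real) \<Rightarrow> nat" and sg :: "(nat \<Rightarrow> real) \<Rightarrow> bool"
  assumes lab: "\<And>x. x \<in> l1_sphere r \<Longrightarrow> lab x < r"
    and odd: "\<And>x. x \<in> l1_sphere r \<Longrightarrow> lab (\<lambda>i. - x i) = lab x" "\<And>x. x \<in> l1_sphere r \<Longrightarrow> sg (\<lambda>i. - x i) = (\<not> sg x)"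
    and "\<delta> > 0"
  obtains u w where "u \<in> l1_sphere r" "w \<in> l1_sphere r" "\<And>i. \<bar>u i - w i\<bar> \<le> \<delta>"
    "lab u = lab w" "sg u" "\<not> sg w"
proof -
  define g :: "(nat \<Rightarrow> real) \<Rightarrow> nat \<Rightarrow> real" where "g x = (\<lambda>i. - x i)" for x
  define e :: "nat \<Rightarrow> nat \<Rightarrow> real" where "e k = (\<lambda>i. if i = k then 1 else 0)" for k
  have gg: "g (g v) = v" for v by (simp add: g_def)
  have cg: "centroid (map g l) = g (centroid l)" for l
    by (auto simp: centroid_def g_def o_def sum_list_minus)
  obtain N where N: "(1 - 1 / real (Suc r)) ^ N < \<delta>"
    using real_arch_pow_inv[OF \<open>\<delta> > 0\<close>, of "1 - 1 / real (Suc r)"] by auto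
  define \<psi> where "\<psi> = (subdiv centroid ^^ N) (fan lab sg True)"
  have Nil: "(subdiv b ^^ N) \<phi> [] = \<phi> []" for b :: "'a list \<Rightarrow> 'a" and \<phi>
    by (induction N) (auto simp: subdiv_def)
  have face: "set (octa_facet e g s k) \<subseteq> l1_face r s" if "k \<le> Suc r" for s k
    using that by (auto simp: octa_facet_def l1_face_def l1_sphere_def e_def g_def if_distrib abs_if cong: if_cong split: if_splits)
  have mesh: "mesh_le 1 (octa_facet e g s k)" for s k
    by (auto simp: octa_facet_def mesh_le_def e_def g_def)
  have "octa e g (Suc r) \<psi> = 1"
  proof (rule octa_eq_1[where m = "Suc r"])
    show "\<psi> [] = 1" by (simp add: \<psi>_def Nil fan_def)
    fix s k assume "k \<le> Suc r"
    let ?l = "octa_facet e g s k"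
    have "cobd \<psi> ?l = \<psi> ?l + (subdiv centroid ^^ N) (fan lab sg False) ?l"
      unfolding \<psi>_def by (simp add: subdiv_iter_cobd[symmetric] cobd_fan[abs_def] subdiv_iter_add)
    also have "(subdiv centroid ^^ N) (fan lab sg False) ?l
        = (subdiv centroid ^^ N) (\<lambda>l. fan lab sg True (map g l)) ?l"
    proof (rule subdiv_iter_cong[OF face centroid_closed_l1_face mesh])
      fix \<tau> assume "set \<tau> \<subseteq> l1_face r s"
      then show "fan lab sg False \<tau> = fan lab sg True (map g \<tau>)"
        using odd by (subst fan_antipodal) (auto simp: g_def l1_face_def)
    qed (use \<open>k \<le> Suc r\<close> in auto)
    also have "\<dots> = \<psi> (map g ?l)"
      unfolding \<psi>_def by (rule subdiv_iter_map[where b = centroid and g = g, OF cg, symmetric])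
    finally show "cobd \<psi> ?l = \<psi> ?l + \<psi> (map g ?l)" .
  qed (auto simp: gg)
  then obtain s where s: "\<psi> (octa_facet e g s (Suc r)) \<noteq> 0"
  proof -
    have "octa e g (Suc r) (\<lambda>l. 0) = 0" by (rule octa_cobd[of _ _ _ "\<lambda>l. 0", unfolded cobd_zero[abs_def]])
    then show ?thesis using that octa_cong[of \<psi> e g "Suc r" "\<lambda>l. 0"] \<open>octa e g (Suc r) \<psi> = 1\<close> by fastforce
  qed
  have "\<exists>\<tau>. set \<tau> \<subseteq> l1_face r s \<and> length \<tau> = Suc r \<and> mesh_le \<delta> \<tau> \<and> fan lab sg True \<tau> \<noteq> 0"
  proof (rule ccontr)
    assume neg: "\<not> ?thesis"
    have "\<psi> (octa_facet e g s (Suc r)) = (subdiv centroid ^^ N) (\<lambda>l. 0) (octa_facet e g s (Suc r))"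
      unfolding \<psi>_def
    proof (rule subdiv_iter_cong[OF face centroid_closed_l1_face mesh])
      fix \<tau> assume \<tau>: "set \<tau> \<subseteq> l1_face r s" "length \<tau> = Suc r" "mesh_le ((1 - 1 / real (Suc r)) ^ N * 1) \<tau>"
      have "mesh_le \<delta> \<tau>" unfolding mesh_le_def
      proof (intro ballI allI)
        fix u w i assume "u \<in> set \<tau>" "w \<in> set \<tau>"
        then have "\<bar>u i - w i\<bar> \<le> (1 - 1 / real (Suc r)) ^ N * 1" using \<tau>(3) unfolding mesh_le_def by blast
        then show "\<bar>u i - w i\<bar> \<le> \<delta>" using N by linarith
      qed
      then show "fan lab sg True \<tau> = 0" using \<tau> neg by auto
    qed (auto simp: octa_facet_def)
    also have "\<dots> = 0"
    proof -
      have "(subdiv centroid ^^ N) (\<lambda>l. 0 + 0) = (\<lambda>l. (subdiv centroid ^^ N) (\<lambda>l. 0) l + (subdiv centroid ^^ N) (\<lambda>l. 0) l)"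
        by (rule subdiv_iter_add)
      then show ?thesis unfolding bit_self by (rule fun_cong)
    qed
    finally show False using s by simp
  qed
  then obtain \<tau> where \<tau>: "set \<tau> \<subseteq> l1_face r s" "length \<tau> = Suc r" "mesh_le \<delta> \<tau>" "fan lab sg True \<tau> \<noteq> 0"
    by blast
  have "\<not> distinct (map lab \<tau>)"
  proof
    assume "distinct (map lab \<tau>)"
    then have "card (lab ` set \<tau>) = Suc r" using distinct_card[of "map lab \<tau>"] \<tau>(2) by simp
    moreover have "lab ` set \<tau> \<subseteq> {..<r}" using \<tau>(1) lab by (auto simp: l1_face_def)
    ultimately show False using card_mono[of "{..<r}" "lab ` set \<tau>"] by simp
  qed
  from fan_nonzero[OF \<tau>(4) this] obtain u w
    where uw: "u \<in> set \<tau>" "w \<in> set \<tau>" "lab u = lab w" "sg u" "\<not> sg w" .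
  have "u \<in> l1_sphere r" "w \<in> l1_sphere r" using uw(1,2) \<tau>(1) by (auto simp: l1_face_def)
  moreover have "\<bar>u i - w i\<bar> \<le> \<delta>" for i using uw(1,2) \<tau>(3) unfolding mesh_le_def by blast
  ultimately show ?thesis using that uw(3-5) by blast
qed

lemma compact_l1_sphere: "compact (l1_sphere r)"
proof -
  define B :: "(nat \<Rightarrow> real) set" where "B = (\<Pi>\<^sub>E i\<in>UNIV. {-1..1})"
  have "compactin (product_topology (\<lambda>i. euclidean) UNIV) B"
    unfolding B_def by (subst compactin_PiE) auto
  then have "compact B" by (simp add: euclidean_product_topology)
  moreover have "closed {x. (\<forall>i>r. x i = 0) \<and> (\<Sum>i\<le>r. \<bar>x i\<bar>) = (1::real)}"
    by (intro closed_Collect_conj closed_Collect_all closed_Collect_imp closed_Collect_eq open_Collect_const continuous_intros)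
       (auto intro: continuous_on_product_coordinates)
  ultimately have "compact (B \<inter> l1_sphere r)" unfolding l1_sphere_def by (rule compact_Int_closed)
  moreover have "l1_sphere r \<subseteq> B"
    using abs_le_1_l1_sphere by (force simp: B_def abs_le_iff)
  ultimately show ?thesis by (simp add: Int_absorb1)
qed

text \<open>
  Points are labelled with the first index at which \<open>F\<close> has the largest absolute value, and with the
  sign of that component. At a limit of the close pairs from Tucker's lemma, the component of
  largest absolute value is both nonnegative and nonpositive.
\<close>
theorem borsuk_ulam_l1:
  fixes F :: "(nat \<Rightarrow> real) \<Rightarrow> nat \<Rightarrow> real"
  assumes odd: "\<And>x i. x \<in> l1_sphere r \<Longrightarrow> i < r \<Longrightarrow> F (\<lambda>j. - x j) i = - F x i"
    and cont: "\<And>X x i. (\<And>k. X k \<in> l1_sphere r) \<Longrightarrow> x \<in> l1_sphere r \<Longrightarrow> (\<And>j. (\<lambda>k. X k j) \<longlonglongrightarrow> x j) \<Longrightarrow>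
      i < r \<Longrightarrow> (\<lambda>k. F (X k) i) \<longlonglongrightarrow> F x i"
  shows "\<exists>x\<in>l1_sphere r. \<forall>i<r. F x i = 0"
proof (rule ccontr)
  assume "\<not> ?thesis"
  then have nz: "\<exists>i<r. F x i \<noteq> 0" if "x \<in> l1_sphere r" for x using that by blast
  define best where "best x i \<longleftrightarrow> i < r \<and> F x i \<noteq> 0 \<and> (\<forall>j<r. \<bar>F x j\<bar> \<le> \<bar>F x i\<bar>)" for x i
  define lab where "lab x = (LEAST i. best x i)" for x
  have ex: "\<exists>i. best x i" if x: "x \<in> l1_sphere r" for x
  proof -
    obtain i0 where i0: "i0 < r" "F x i0 \<noteq> 0" using nz[OF x] by blast
    define M where "M = Max ((\<lambda>i. \<bar>F x i\<bar>) ` {..<r})"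
    have "M \<in> (\<lambda>i. \<bar>F x i\<bar>) ` {..<r}" unfolding M_def using i0 by (intro Max_in) auto
    then obtain i where i: "i < r" "M = \<bar>F x i\<bar>" by auto
    have "\<bar>F x j\<bar> \<le> \<bar>F x i\<bar>" if "j < r" for j unfolding i(2)[symmetric] M_def using that by (intro Max_ge) auto
    then have "best x i" using i i0 by (force simp: best_def)
    then show ?thesis ..
  qed
  have best: "best x (lab x)" if "x \<in> l1_sphere r" for x
    unfolding lab_def using ex[OF that] by (rule LeastI_ex)
  define sg where "sg x \<longleftrightarrow> F x (lab x) > 0" for x
  have lab_odd: "lab (\<lambda>i. - x i) = lab x" if "x \<in> l1_sphere r" for x
  proof -
    have "best (\<lambda>i. - x i) = best x" using odd[OF that] by (auto simp: best_def fun_eq_iff)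
    then show ?thesis by (simp add: lab_def)
  qed
  have sg_odd: "sg (\<lambda>i. - x i) = (\<not> sg x)" if x: "x \<in> l1_sphere r" for x
    using best[OF x] odd[OF x, of "lab x"] by (auto simp: sg_def lab_odd[OF x] best_def)
  have "\<exists>u w. u \<in> l1_sphere r \<and> w \<in> l1_sphere r \<and> (\<forall>i. \<bar>u i - w i\<bar> \<le> 1 / real (Suc k))
      \<and> lab u = lab w \<and> sg u \<and> \<not> sg w" for k
    by (rule tucker_l1_sphere[of r lab sg "1 / real (Suc k)"]) (use best best_def lab_odd sg_odd in auto)
  then obtain U W where UW: "\<And>k. U k \<in> l1_sphere r" "\<And>k. W k \<in> l1_sphere r"
    "\<And>k i. \<bar>U k i - W k i\<bar> \<le> 1 / real (Suc k)" "\<And>k. lab (U k) = lab (W k)" "\<And>k. sg (U k)" "\<And>k. \<not> sg (W k)"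
    by metis
  have "\<exists>i. infinite {k \<in> UNIV. lab (U k) = i}"
  proof (rule ccontr)
    assume *: "\<not> ?thesis"
    have "finite (\<Union>i\<in>{..<r}. {k \<in> UNIV. lab (U k) = i})"
      by (rule finite_UN_I) (use * in auto)
    moreover have "(\<Union>i\<in>{..<r}. {k \<in> UNIV. lab (U k) = i}) = UNIV"
      using best[OF UW(1)] by (auto simp: best_def)
    ultimately show False using infinite_UNIV_nat by metis
  qed
  then obtain i where inf: "infinite {k. lab (U k) = i}" by auto
  define q where "q = enumerate {k. lab (U k) = i}"
  have q: "strict_mono q" "\<And>k. lab (U (q k)) = i"
    using inf enumerate_in_set[OF inf] by (auto simp: q_def strict_mono_enumerate)
  have "seq_compact (l1_sphere r)" by (rule compact_imp_seq_compact[OF compact_l1_sphere])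
  then obtain x p where x: "x \<in> l1_sphere r" and p: "strict_mono p" "((U \<circ> q) \<circ> p) \<longlonglongrightarrow> x"
    unfolding seq_compact_def using UW(1) by (metis comp_apply)
  define h where "h = q \<circ> p"
  have h: "strict_mono h" unfolding h_def by (rule strict_mono_o[OF q(1) p(1)])
  have Ux: "(\<lambda>k. U (h k) j) \<longlonglongrightarrow> x j" for j
  proof -
    have "isCont (\<lambda>x. x j) x" 
      using continuous_on_product_coordinates[of j] continuous_on_eq_continuous_at[OF open_UNIV] by blast
    from isCont_tendsto_compose[OF this p(2)] show ?thesis by (simp add: h_def o_def)
  qed
  have Wx: "(\<lambda>k. W (h k) j) \<longlonglongrightarrow> x j" for j
  proof -
    have "(\<lambda>k. 1 / real (Suc (h k))) \<longlonglongrightarrow> 0"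
      using LIMSEQ_subseq_LIMSEQ[OF LIMSEQ_inverse_real_of_nat h] by (simp add: o_def inverse_eq_divide)
    then have "(\<lambda>k. U (h k) j - W (h k) j) \<longlonglongrightarrow> 0"
      by (rule Lim_null_comparison[rotated]) (use UW(3) in auto)
    from tendsto_diff[OF Ux[of j] this] show ?thesis by simp
  qed
  have lab_h: "lab (U (h k)) = i" "lab (W (h k)) = i" for k using q(2) UW(4) by (auto simp: h_def)
  have i: "i < r" using best[OF UW(1)[of "h 0"]] by (simp add: lab_h best_def)
  have limU: "(\<lambda>k. F (U (h k)) j) \<longlonglongrightarrow> F x j" if "j < r" for j by (rule cont) (use UW x Ux that in auto)
  have limW: "(\<lambda>k. F (W (h k)) i) \<longlonglongrightarrow> F x i" by (rule cont) (use UW x Wx i in auto)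
  have "F x i \<le> 0" by (rule LIMSEQ_le_const2[OF limW]) (use UW(6)[unfolded sg_def not_less, of "h _", unfolded lab_h] in blast)
  moreover have "\<bar>F x j\<bar> \<le> F x i" if j: "j < r" for j
  proof (rule LIMSEQ_le[OF tendsto_rabs[OF limU[OF j]] limU[OF i]], intro exI allI impI)
    fix k show "\<bar>F (U (h k)) j\<bar> \<le> F (U (h k)) i"
      using best[OF UW(1)[of "h k"]] UW(5)[of "h k"] j by (auto simp: best_def sg_def lab_h)
  qed
  ultimately show False using nz[OF x] by force
qed

section \<open>A smooth step function\<close>

text \<open>
  \<open>f\<close> is \<open>k\<close> times differentiable on the whole real line. The \<open>k\<close>-th derivative need not be continuous,
  which makes no difference when \<open>k\<close> is arbitrary.
\<close>
primrec times_differentiable :: "nat \<Rightarrow> (real \<Rightarrow> real) \<Rightarrow> bool" where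
  "times_differentiable 0 f \<longleftrightarrow> True"
| "times_differentiable (Suc k) f \<longleftrightarrow>
     (\<forall>t. (f has_real_derivative deriv f t) (at t)) \<and> times_differentiable k (deriv f)"

lemma times_differentiable_SucI:
  assumes "\<And>t. (f has_real_derivative f' t) (at t)" "times_differentiable k f'"
  shows "times_differentiable (Suc k) f"
proof -
  have "deriv f = f'" using assms(1) DERIV_imp_deriv by blast
  then show ?thesis using assms by simp
qed

lemma times_differentiable_SucD: "times_differentiable (Suc k) f \<Longrightarrow> times_differentiable k f"
  by (induction k arbitrary: f) auto

lemma times_differentiable_const: "times_differentiable k (\<lambda>t. c)"
  by (induction k arbitrary: c) (auto intro!: times_differentiable_SucI[where f' = "\<lambda>t. 0"] derivative_eq_intros)

lemma times_differentiable_add: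
  "times_differentiable k f \<Longrightarrow> times_differentiable k g \<Longrightarrow> times_differentiable k (\<lambda>t. f t + g t)"
proof (induction k arbitrary: f g)
  case (Suc k)
  show ?case
    by (rule times_differentiable_SucI[where f' = "\<lambda>t. deriv f t + deriv g t"])
       (use Suc in \<open>auto intro!: DERIV_add\<close>)
qed simp

lemma times_differentiable_mult:
  "times_differentiable k f \<Longrightarrow> times_differentiable k g \<Longrightarrow> times_differentiable k (\<lambda>t. f t * g t)"
proof (induction k arbitrary: f g)
  case (Suc k)
  have "times_differentiable k (\<lambda>t. deriv f t * g t + deriv g t * f t)"
    using Suc times_differentiable_SucD by (intro times_differentiable_add Suc.IH) auto
  then show ?case
    by (rule times_differentiable_SucI[rotated]) (use Suc.prems in \<open>auto intro!: DERIV_mult\<close>)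
qed simp

lemma times_differentiable_sum:
  "(\<And>i. i \<in> A \<Longrightarrow> times_differentiable k (f i)) \<Longrightarrow> times_differentiable k (\<lambda>t. \<Sum>i\<in>A. f i t)"
  by (induction A rule: infinite_finite_induct) (auto intro: times_differentiable_const times_differentiable_add)

text \<open>
  This includes \<open>c = 0\<close>, where division by zero yields a constant function.
\<close>
lemma DERIV_affine_compose:
  assumes "\<And>t. (f has_real_derivative f' t) (at t)"
  shows "((\<lambda>t. f ((t - a) / c)) has_real_derivative 1 / c * f' ((t - a) / c)) (at t)"
proof -
  have "((\<lambda>t. (t - a) / c) has_real_derivative 1 / c) (at t)"
    by (cases "c = 0") (auto intro!: derivative_eq_intros)
  then show ?thesis using DERIV_chain2[of f _ "\<lambda>t. (t - a) / c", OF assms] by (metis mult.commute)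
qed

lemma times_differentiable_affine:
  "times_differentiable k f \<Longrightarrow> times_differentiable k (\<lambda>t. f ((t - a) / c))"
proof (induction k arbitrary: f)
  case (Suc k)
  have "times_differentiable k (\<lambda>t. 1 / c * deriv f ((t - a) / c))"
    using Suc by (intro times_differentiable_mult times_differentiable_const) auto
  moreover have "((\<lambda>t. f ((t - a) / c)) has_real_derivative 1 / c * deriv f ((t - a) / c)) (at t)" for t
    by (rule DERIV_affine_compose) (use Suc.prems in simp)
  ultimately show ?case by (intro times_differentiable_SucI)
qed simp

lemma times_differentiable_poly: "times_differentiable k (poly p)"
proof (induction k arbitrary: p)
  case (Suc k)
  show ?case by (rule times_differentiable_SucI[OF poly_DERIV Suc])
qed simp

lemma smooth_on_if_times_differentiable:
  assumes "\<And>k. times_differentiable k f"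
  shows "smooth_on S f"
  unfolding smooth_on_def
proof (intro exI[of _ "\<lambda>k. (deriv ^^ k) f"] conjI allI ballI)
  have "times_differentiable j ((deriv ^^ k) f)" for j k
    by (induction k arbitrary: j) (use assms in auto, metis times_differentiable.simps(2))
  then have "((deriv ^^ k) f has_real_derivative (deriv ^^ Suc k) f t) (at t)" for k t
    using times_differentiable.simps(2)[of 0 "(deriv ^^ k) f"] by (metis comp_apply funpow.simps(2))
  then show "((deriv ^^ k) f has_vector_derivative (deriv ^^ Suc k) f t) (at t within S)" for k t
    using has_field_derivative_at_within has_real_derivative_iff_has_vector_derivative by blast
qed simp

text \<open>
  The functions \<open>p (1 / t) * exp (- 1 / t)\<close> on the positive half-line, extended by 0. They are closed
  under differentiation and therefore smooth.
\<close>
definition exp_flat :: "real poly \<Rightarrow> real \<Rightarrow> real" where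
  "exp_flat p t = (if t > 0 then poly p (1 / t) * exp (- (1 / t)) else 0)"

lemma exp_flat_tendsto_0: "(exp_flat p \<longlongrightarrow> 0) (at 0)"
proof -
  have "((\<lambda>x::real. \<Sum>i\<le>degree p. coeff p i * (x ^ i / exp x)) \<longlongrightarrow> (\<Sum>i\<le>degree p. coeff p i * 0)) at_top"
    by (intro tendsto_intros tendsto_power_div_exp_0)
  moreover have "(\<lambda>x::real. \<Sum>i\<le>degree p. coeff p i * (x ^ i / exp x)) = (\<lambda>x. poly p x * exp (- x))"
    by (simp add: poly_altdef sum_distrib_right exp_minus divide_inverse mult.assoc)
  ultimately have "((\<lambda>x. poly p x * exp (- x)) \<longlongrightarrow> 0) at_top" by simp
  from filterlim_compose[OF this filterlim_inverse_at_top_right]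
  have "((\<lambda>t. poly p (inverse t) * exp (- inverse t)) \<longlongrightarrow> 0) (at_right 0)" .
  then have "(exp_flat p \<longlongrightarrow> 0) (at_right 0)"
    by (rule Lim_transform_eventually)
       (auto simp: exp_flat_def inverse_eq_divide eventually_at_filter)
  moreover have "(exp_flat p \<longlongrightarrow> 0) (at_left 0)"
    by (rule Lim_transform_eventually[OF tendsto_const])
       (auto simp: exp_flat_def eventually_at_filter)
  ultimately show ?thesis by (simp add: filterlim_split_at)
qed

lemma exp_flat_DERIV:
  "(exp_flat p has_real_derivative exp_flat ([:0, 0, 1:] * (p - pderiv p)) t) (at t)"
proof -
  consider "t > 0" | "t < 0" | "t = 0" by linarith
  then show ?thesis
  proof cases
    case 1
    have "((\<lambda>t. poly p (1 / t) * exp (- (1 / t))) has_real_derivative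
        exp_flat ([:0, 0, 1:] * (p - pderiv p)) t) (at t)"
      using 1 by (auto intro!: derivative_eq_intros poly_DERIV[THEN DERIV_chain2]
          simp: exp_flat_def field_simps power2_eq_square)
    then show ?thesis
      by (rule has_field_derivative_transform_within_open[where S = "{0<..}"])
         (use 1 in \<open>auto simp: exp_flat_def\<close>)
  next
    case 2
    have "((\<lambda>t. 0) has_real_derivative exp_flat ([:0, 0, 1:] * (p - pderiv p)) t) (at t)"
      using 2 by (simp add: exp_flat_def)
    then show ?thesis
      by (rule has_field_derivative_transform_within_open[where S = "{..<0}"])
         (use 2 in \<open>auto simp: exp_flat_def\<close>)
  next
    case 3
    have "(exp_flat (pCons 0 p) \<longlongrightarrow> 0) (at 0)" by (rule exp_flat_tendsto_0)
    moreover have "exp_flat (pCons 0 p) = (\<lambda>h. (exp_flat p (0 + h) - exp_flat p 0) / h)"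
      by (auto simp: exp_flat_def fun_eq_iff)
    ultimately show ?thesis
      unfolding has_field_derivative_def[symmetric] 3 by (simp add: DERIV_def exp_flat_def)
  qed
qed

lemma times_differentiable_exp_flat: "times_differentiable k (exp_flat p)"
proof (induction k arbitrary: p)
  case (Suc k)
  show ?case by (rule times_differentiable_SucI[OF exp_flat_DERIV Suc])
qed simp

lemma smooth_step_exists:
  obtains g :: "real \<Rightarrow> real" where
    "\<And>k. times_differentiable k g" "\<And>t. t \<le> 0 \<Longrightarrow> g t = 0" "\<And>t. 1 \<le> t \<Longrightarrow> g t = 1" "mono g"
proof -
  \<comment> \<open>the step is the normalised primitive of a bump with support \<open>[0, 1]\<close>\<close>
  define b where "b t = exp_flat 1 t * exp_flat 1 (- (t - 1))" for t
  have b_smooth: "times_differentiable k b" for k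
  proof -
    have "times_differentiable k (\<lambda>t. exp_flat 1 ((t - 1) / - 1))"
      by (intro times_differentiable_affine times_differentiable_exp_flat)
    then show ?thesis
      unfolding b_def by (intro times_differentiable_mult times_differentiable_exp_flat) simp
  qed
  have "continuous_on UNIV b"
    using b_smooth[of 1] by (auto intro!: DERIV_isCont continuous_at_imp_continuous_on)
  obtain K where K: "(K has_real_derivative b t) (at t)" for t
    using einterval_antiderivative[of "-\<infinity>" "\<infinity>" b] \<open>continuous_on UNIV b\<close>
    by (auto simp: has_real_derivative_iff_has_vector_derivative continuous_on_eq_continuous_at)
  have b: "b t \<ge> 0" "0 < t \<Longrightarrow> t < 1 \<Longrightarrow> b t > 0" "t \<le> 0 \<Longrightarrow> b t = 0" "t \<ge> 1 \<Longrightarrow> b t = 0" for t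
    by (auto simp: b_def exp_flat_def)
  have K_cont: "continuous_on A K" for A by (intro continuous_at_imp_continuous_on ballI DERIV_isCont[OF K])
  have "mono K"
  proof (rule monoI)
    fix x y :: real assume "x \<le> y"
    then show "K x \<le> K y"
      by (rule DERIV_nonneg_imp_nondecreasing[of x y K]) (use K b(1) in blast)
  qed
  have "K 0 < K 1"
  proof (rule DERIV_pos_imp_increasing_open[of 0 1 K])
    show "\<exists>y. (K has_real_derivative y) (at t) \<and> 0 < y" if "0 < t" "t < 1" for t
      using K[of t] b(2)[OF that] by blast
  qed (simp_all add: K_cont)
  have K0: "K t = K 0" if "t \<le> 0" for t
  proof (rule antisym)
    show "K t \<le> K 0" using \<open>mono K\<close> that by (rule monoD)
    have "\<exists>y. (K has_real_derivative y) (at s) \<and> y \<le> 0" if "t \<le> s" "s \<le> 0" for s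
      using K[of s] b(3)[of s] that by (intro exI[of _ "b s"]) auto
    then show "K 0 \<le> K t" using that by (intro DERIV_nonpos_imp_nonincreasing[of _ _ K]) auto
  qed
  have K1: "K t = K 1" if "1 \<le> t" for t
  proof (rule antisym)
    show "K 1 \<le> K t" using \<open>mono K\<close> that by (rule monoD)
    have "\<exists>y. (K has_real_derivative y) (at s) \<and> y \<le> 0" if "1 \<le> s" "s \<le> t" for s
      using K[of s] b(4)[of s] that by (intro exI[of _ "b s"]) auto
    then show "K t \<le> K 1" using that by (intro DERIV_nonpos_imp_nonincreasing[of _ _ K]) auto
  qed
  have K_smooth: "times_differentiable k K" for k
  proof (cases k)
    case (Suc j)
    show ?thesis unfolding Suc by (rule times_differentiable_SucI[OF K b_smooth])
  qed simp
  define g where "g t = 1 / (K 1 - K 0) * (K t + - K 0)" for t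
  have gs: "times_differentiable k g" for k
    unfolding g_def by (intro times_differentiable_mult times_differentiable_add times_differentiable_const K_smooth)
  show ?thesis
  proof
    show "times_differentiable k g" for k by (fact gs)
    show "g t = 0" if "t \<le> 0" for t using K0[OF that] by (simp add: g_def)
    show "g t = 1" if "1 \<le> t" for t using K1[OF that] \<open>K 0 < K 1\<close> by (simp add: g_def)
    show "mono g" unfolding g_def[abs_def]
    proof (intro monoI mult_left_mono add_right_mono)
      show "K x \<le> K y" if "x \<le> y" for x y using \<open>mono K\<close> that by (rule monoD)
    qed (use \<open>K 0 < K 1\<close> in simp)
  qed
qed

section \<open>Tools from linear algebra and integration\<close>

text \<open>
  Banach's fixed point theorem for finitely many real coordinates with the sum norm. The number of
  coordinates is a parameter, so points are sequences of which only the first \<open>r\<close> entries matter.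
\<close>
lemma sum_contraction_fixpoint:
  fixes T :: "(nat \<Rightarrow> real) \<Rightarrow> nat \<Rightarrow> real" and \<eta> :: real and r :: nat
  defines "N \<equiv> \<lambda>y. \<Sum>i<r. \<bar>y i\<bar>"
  assumes contr: "\<And>y y'. N y \<le> \<eta> \<Longrightarrow> N y' \<le> \<eta> \<Longrightarrow> N (\<lambda>i. T y i - T y' i) \<le> 1 / 2 * N (\<lambda>i. y i - y' i)"
    and T0: "N (T (\<lambda>i. 0)) \<le> \<eta> / 2"
  shows "\<exists>y. N y \<le> \<eta> \<and> (\<forall>i<r. T y i = y i)"
proof -
  define Y where "Y k = (T ^^ k) (\<lambda>i. 0)" for k
  have Y: "Y 0 = (\<lambda>i. 0)" "Y (Suc k) = T (Y k)" for k by (auto simp: Y_def)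
  have N_nonneg: "0 \<le> N y" for y by (simp add: N_def sum_nonneg)
  have N_tri: "N (\<lambda>i. a i + b i) \<le> N a + N b" for a b
    unfolding N_def by (simp add: sum.distrib[symmetric] sum_mono abs_triangle_ineq)
  have N_zero: "N (\<lambda>i. 0) = 0" by (simp add: N_def)
  have \<eta>: "0 \<le> \<eta>" using T0 N_nonneg[of "T (\<lambda>i. 0)"] by linarith
  have ball: "N (T y) \<le> \<eta>" if "N y \<le> \<eta>" for y
  proof -
    have "N (T y) \<le> N (\<lambda>i. T y i - T (\<lambda>i. 0) i) + N (T (\<lambda>i. 0))"
      using N_tri[of "\<lambda>i. T y i - T (\<lambda>i. 0) i" "T (\<lambda>i. 0)"] by simp
    then show ?thesis using contr[of y "\<lambda>i. 0"] that T0 \<eta> by (simp add: N_zero)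
  qed
  have YN: "N (Y k) \<le> \<eta>" for k by (induction k) (auto simp: Y ball \<eta> N_zero)
  have step: "N (\<lambda>i. Y (Suc k) i - Y k i) \<le> \<eta> * (1 / 2) ^ k" for k
  proof (induction k)
    case 0
    then show ?case using YN[of 1] by (simp add: Y)
  next
    case (Suc k)
    then show ?case using contr[OF YN YN, of "Suc k" k] by (simp add: Y)
  qed
  have le_N: "\<bar>y i\<bar> \<le> N y" if "i < r" for y i
    unfolding N_def using that by (intro member_le_sum) auto
  have "\<exists>l. (\<lambda>k. Y k i) \<longlonglongrightarrow> l" if i: "i < r" for i
  proof -
    have "summable (\<lambda>k. Y (Suc k) i - Y k i)"
    proof (rule summable_comparison_test')
      show "summable (\<lambda>k. \<eta> * (1 / 2) ^ k)" by (intro summable_mult summable_geometric) simp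
      show "norm (Y (Suc k) i - Y k i) \<le> \<eta> * (1 / 2) ^ k" for k
        using le_N[OF i, of "\<lambda>i. Y (Suc k) i - Y k i"] step[of k] by simp
    qed
    then have "(\<lambda>n. \<Sum>k<n. Y (Suc k) i - Y k i) \<longlonglongrightarrow> (\<Sum>k. Y (Suc k) i - Y k i)"
      by (rule summable_LIMSEQ)
    then show ?thesis unfolding sum_lessThan_telescope[of "\<lambda>k. Y k i"] Y(1) by (auto intro: exI)
  qed
  then obtain y where y: "\<And>i. i < r \<Longrightarrow> (\<lambda>k. Y k i) \<longlonglongrightarrow> y i" by metis
  have "(\<lambda>k. N (Y k)) \<longlonglongrightarrow> N y" unfolding N_def by (intro tendsto_intros y) simp
  then have yN: "N y \<le> \<eta>" by (rule LIMSEQ_le_const2) (use YN in auto)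
  have "(\<lambda>k. N (\<lambda>i. y i - Y k i)) \<longlonglongrightarrow> (\<Sum>i<r. \<bar>y i - y i\<bar>)"
    unfolding N_def by (intro tendsto_intros y) simp
  then have dist0: "(\<lambda>k. N (\<lambda>i. y i - Y k i)) \<longlonglongrightarrow> 0" by simp
  have "T y i = y i" if i: "i < r" for i
  proof -
    have "(\<lambda>k. T y i - Y (Suc k) i) \<longlonglongrightarrow> 0"
    proof (rule Lim_null_comparison[OF _ dist0], intro always_eventually allI)
      fix k
      have "\<bar>T y i - T (Y k) i\<bar> \<le> N (\<lambda>i. y i - Y k i)"
        using le_N[OF i, of "\<lambda>i. T y i - T (Y k) i"] contr[OF yN YN, of k] N_nonneg[of "\<lambda>i. y i - Y k i"] by linarith
      then show "norm (T y i - Y (Suc k) i) \<le> N (\<lambda>i. y i - Y k i)" by (simp add: Y)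
    qed
    moreover have "(\<lambda>k. T y i - Y (Suc k) i) \<longlonglongrightarrow> T y i - y i"
      using LIMSEQ_Suc[OF y[OF i]] by (intro tendsto_intros)
    ultimately show ?thesis using LIMSEQ_unique by fastforce
  qed
  then show ?thesis using yN by blast
qed

text \<open>
  Finitely many linear functionals on polynomials are spanned by some \<open>r\<close> of them that admit a dual
  family of polynomials.
\<close>
lemma dual_basis:
  fixes L :: "nat \<Rightarrow> real poly \<Rightarrow> real"
  assumes add: "\<And>k p q. k < m \<Longrightarrow> L k (p + q) = L k p + L k q"
    and smult: "\<And>k c p. k < m \<Longrightarrow> L k (smult c p) = c * L k p"
  shows "\<exists>r idx q A. r \<le> m \<and> (\<forall>i<r. idx i < m) \<and>
    (\<forall>i<r. \<forall>j<r. L (idx i) (q j) = of_bool (i = j)) \<and>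
    (\<forall>k<m. \<forall>p. L k p = (\<Sum>i<r. A k i * L (idx i) p))"
  using assms
proof (induction m)
  case 0
  then show ?case by (intro exI[of _ "0::nat"]) auto
next
  case (Suc m)
  obtain r idx q A where IH: "r \<le> m" "\<And>i. i < r \<Longrightarrow> idx i < m"
    "\<And>i j. i < r \<Longrightarrow> j < r \<Longrightarrow> L (idx i) (q j) = of_bool (i = j)"
    "\<And>k p. k < m \<Longrightarrow> L k p = (\<Sum>i<r. A k i * L (idx i) p)"
  proof -
    have "\<exists>r idx q A. r \<le> m \<and> (\<forall>i<r. idx i < m) \<and>
      (\<forall>i<r. \<forall>j<r. L (idx i) (q j) = of_bool (i = j)) \<and>
      (\<forall>k<m. \<forall>p. L k p = (\<Sum>i<r. A k i * L (idx i) p))"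
      by (rule Suc.IH) (rule Suc.prems, simp)+
    then show ?thesis using that by blast
  qed
  have lin_sum: "L k (\<Sum>i\<in>B. smult (c i) (p i)) = (\<Sum>i\<in>B. c i * L k (p i))" if "k < Suc m" for k c p and B :: "nat set"
    using Suc.prems(2)[OF that, of 0 0]
    by (induction B rule: infinite_finite_induct) (simp_all add: Suc.prems(1)[OF that] Suc.prems(2)[OF that])
  have diff: "L k (p - p') = L k p - L k p'" if "k < Suc m" for k p p'
    using Suc.prems(1)[OF that, of p "smult (- 1) p'"] Suc.prems(2)[OF that, of "-1" p'] by simp
  \<comment> \<open>the part of \<open>L m\<close> that vanishes on all \<open>q i\<close>\<close>
  define M where "M p = L m p - (\<Sum>i<r. L m (q i) * L (idx i) p)" for p
  show ?case
  proof (cases "\<forall>p. M p = 0")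
    case True
    define A' where "A' k = (if k = m then (\<lambda>i. L m (q i)) else A k)" for k
    have "L k p = (\<Sum>i<r. A' k i * L (idx i) p)" if k: "k < Suc m" for k p
    proof (cases "k = m")
      case True
      have "M p = 0" using \<open>\<forall>p. M p = 0\<close> ..
      then have "L m p = (\<Sum>i<r. L m (q i) * L (idx i) p)" by (simp only: M_def eq_iff_diff_eq_0[symmetric])
      then show ?thesis unfolding True by (simp add: A'_def)
    next
      case False
      moreover have "L k p = (\<Sum>i<r. A k i * L (idx i) p)" using False k by (intro IH(4)) simp
      ultimately show ?thesis by (simp add: A'_def)
    qed
    moreover have "r \<le> Suc m" "\<And>i. i < r \<Longrightarrow> idx i < Suc m" using IH(1,2) by (auto simp: less_Suc_eq)
    ultimately show ?thesis using IH(3)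
      by (intro exI[of _ r] exI[of _ idx] exI[of _ q] exI[of _ A']) blast
  next
    case False
    then obtain p0 where p0: "M p0 \<noteq> 0" by blast
    define p1 where "p1 = p0 - (\<Sum>i<r. smult (L (idx i) p0) (q i))"
    have idx_p1: "L (idx j) p1 = 0" if j: "j < r" for j
    proof -
      have "idx j < Suc m" using IH(2)[OF j] by simp
      then have "L (idx j) p1 = L (idx j) p0 - (\<Sum>i<r. L (idx i) p0 * L (idx j) (q i))"
        by (simp add: p1_def diff lin_sum)
      also have "(\<Sum>i<r. L (idx i) p0 * L (idx j) (q i)) = (\<Sum>i<r. if i = j then L (idx i) p0 else 0)"
        by (rule sum.cong) (use IH(3) j in auto)
      finally show ?thesis using j by simp
    qed
    have m_p1: "L m p1 = M p0"
      by (simp add: p1_def diff lin_sum M_def mult.commute)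
    define q1 where "q1 = smult (1 / M p0) p1"
    define q' where "q' j = (if j = r then q1 else q j - smult (L m (q j)) q1)" for j
    define idx' where "idx' j = (if j = r then m else idx j)" for j
    define A' where "A' k i = (if k = m then of_bool (i = r) else if i = r then 0 else A k i)" for k i
    have q1: "L m q1 = 1" "j < r \<Longrightarrow> L (idx j) q1 = 0" for j
      using Suc.prems(2)[of m "1 / M p0" p1] Suc.prems(2)[of "idx j" "1 / M p0" p1] IH(2)[of j] p0
      by (auto simp: q1_def m_p1 idx_p1)
    have "L (idx' i) (q' j) = of_bool (i = j)" if "i < Suc r" "j < Suc r" for i j
    proof -
      have "L k (q j - smult (L m (q j)) q1) = L k (q j) - L m (q j) * L k q1" if "k < Suc m" for k
        using diff[OF that] Suc.prems(2)[OF that] by simp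
      then show ?thesis
        using that IH(2)[of i] IH(3)[of i j] q1 by (auto simp: idx'_def q'_def less_Suc_eq)
    qed
    moreover have "L k p = (\<Sum>i<Suc r. A' k i * L (idx' i) p)" if k: "k < Suc m" for k p
    proof (cases "k = m")
      case True
      then have "(\<Sum>i<r. A' k i * L (idx' i) p) = 0" by (intro sum.neutral) (auto simp: A'_def)
      then show ?thesis using True by (simp add: A'_def idx'_def)
    next
      case False
      then have "(\<Sum>i<r. A' k i * L (idx' i) p) = (\<Sum>i<r. A k i * L (idx i) p)"
        by (intro sum.cong) (auto simp: A'_def idx'_def)
      moreover have "L k p = (\<Sum>i<r. A k i * L (idx i) p)" using False k by (intro IH(4)) simp
      ultimately show ?thesis using False by (simp add: A'_def)
    qed
    moreover have "idx' i < Suc m" if "i < Suc r" for i using that IH(2) by (auto simp: idx'_def less_Suc_eq)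
    moreover have "Suc r \<le> Suc m" using IH(1) by simp
    ultimately show ?thesis
      by (intro exI[of _ "Suc r"] exI[of _ idx'] exI[of _ q'] exI[of _ A']) blast
  qed
qed

lemma integrable_mult_bounded:
  fixes P h :: "real \<Rightarrow> real"
  assumes "integrable lebesgue P" "h \<in> borel_measurable lebesgue" "\<And>t. P t \<noteq> 0 \<Longrightarrow> \<bar>h t\<bar> \<le> C"
  shows "integrable lebesgue (\<lambda>t. P t * h t)"
proof (rule Bochner_Integration.integrable_bound)
  show "integrable lebesgue (\<lambda>t. C * P t)" using assms by simp
  show "(\<lambda>t. P t * h t) \<in> borel_measurable lebesgue" using assms by measurable
  have "\<bar>P t * h t\<bar> \<le> \<bar>C * P t\<bar>" for t
  proof (cases "P t = 0")
    case False
    have "\<bar>h t\<bar> * \<bar>P t\<bar> \<le> \<bar>C\<bar> * \<bar>P t\<bar>" using assms(3)[OF False] by (intro mult_right_mono) auto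
    then show ?thesis by (simp add: abs_mult mult.commute)
  qed simp
  then show "AE t in lebesgue. norm (P t * h t) \<le> norm (C * P t)" by simp
qed

lemma integrable_mult_continuous:
  fixes D g :: "real \<Rightarrow> real"
  assumes D: "integrable lebesgue D" "\<And>t. t \<notin> {0..1} \<Longrightarrow> D t = 0" and g: "continuous_on UNIV g"
  shows "integrable lebesgue (\<lambda>t. D t * g t)"
proof -
  have "bounded (g ` {0..1})" using g by (intro compact_imp_bounded compact_continuous_image) (auto intro: continuous_on_subset)
  then obtain C where "\<And>t. t \<in> {0..1} \<Longrightarrow> \<bar>g t\<bar> \<le> C" unfolding bounded_iff by (metis imageI real_norm_def)
  then show ?thesis using D(2) g
    by (intro integrable_mult_bounded[OF D(1)]) (auto intro!: measurable_completion intro: borel_measurable_continuous_onI)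
qed

lemma orthogonal_continuous_if_orthogonal_poly:
  fixes D h :: "real \<Rightarrow> real"
  assumes D: "integrable lebesgue D" "\<And>t. t \<notin> {0..1} \<Longrightarrow> D t = 0"
    and poly: "\<And>p. (LINT t|lebesgue. D t * poly p t) = 0"
    and h: "continuous_on UNIV h"
  shows "(LINT t|lebesgue. D t * h t) = 0"
proof -
  note cont_int = integrable_mult_continuous[OF D]
  have "\<bar>LINT t|lebesgue. D t * h t\<bar> \<le> \<epsilon> * (LINT t|lebesgue. \<bar>D t\<bar>)" if \<epsilon>: "\<epsilon> > 0" for \<epsilon>
  proof -
    obtain n where n: "\<And>x. x \<in> {0..1} \<Longrightarrow> \<bar>h x - (\<Sum>k\<le>n. h (real k / real n) * Bernstein n k x)\<bar> < \<epsilon>"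
      using Bernstein_Weierstrass[of h \<epsilon>] \<epsilon> h by (meson continuous_on_subset order_refl subset_UNIV)
    define p where "p = (\<Sum>k\<le>n. smult (h (real k / real n)) (smult (real (n choose k)) ([:0, 1:] ^ k * [:1, -1:] ^ (n - k))))"
    have p: "poly p x = (\<Sum>k\<le>n. h (real k / real n) * Bernstein n k x)" for x
      by (simp add: p_def poly_sum Bernstein_def mult_ac)
    have "(LINT t|lebesgue. D t * h t) = (LINT t|lebesgue. D t * h t) - (LINT t|lebesgue. D t * poly p t)"
      using poly by simp
    also have "\<dots> = (LINT t|lebesgue. D t * h t - D t * poly p t)"
      by (rule Bochner_Integration.integral_diff[symmetric]) (auto intro!: cont_int h continuous_intros)
    also have "\<bar>\<dots>\<bar> \<le> (LINT t|lebesgue. \<epsilon> * \<bar>D t\<bar>)"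
    proof -
      have i: "integrable lebesgue (\<lambda>t. D t * h t - D t * poly p t)"
        by (rule Bochner_Integration.integrable_diff) (auto intro!: cont_int h continuous_intros)
      have le: "\<bar>D t * h t - D t * poly p t\<bar> \<le> \<epsilon> * \<bar>D t\<bar>" for t
      proof (cases "t \<in> {0..1}")
        case True
        have "\<bar>D t\<bar> * \<bar>h t - poly p t\<bar> \<le> \<bar>D t\<bar> * \<epsilon>"
          using n[OF True] p[of t] by (intro mult_left_mono) auto
        then show ?thesis by (simp add: abs_mult[symmetric] algebra_simps)
      qed (use D(2) in auto)
      have "\<bar>LINT t|lebesgue. D t * h t - D t * poly p t\<bar> \<le> (LINT t|lebesgue. \<bar>D t * h t - D t * poly p t\<bar>)"
        using integral_norm_bound[of lebesgue "\<lambda>t. D t * h t - D t * poly p t"] by simp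
      also have "\<dots> \<le> (LINT t|lebesgue. \<epsilon> * \<bar>D t\<bar>)"
        by (rule integral_mono) (use i D(1) le in auto)
      finally show ?thesis .
    qed
    finally show ?thesis by simp
  qed
  note bound = this
  define W where "W = (LINT t|lebesgue. \<bar>D t\<bar>)"
  have "W \<ge> 0" by (simp add: W_def)
  have "\<bar>LINT t|lebesgue. D t * h t\<bar> \<le> 0"
  proof (rule field_le_epsilon)
    fix e :: real assume "e > 0"
    have "e / (W + 1) * W \<le> e" using \<open>e > 0\<close> \<open>W \<ge> 0\<close> by (simp add: field_simps)
    then show "\<bar>LINT t|lebesgue. D t * h t\<bar> \<le> 0 + e"
      using bound[of "e / (W + 1)"] \<open>e > 0\<close> \<open>W \<ge> 0\<close> by (simp add: W_def[symmetric])
  qed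
  then show ?thesis by simp
qed

text \<open>
  Absolute continuity of the integral, by truncation at a large level \<open>M\<close>.
\<close>
lemma small_integral_small_sets:
  fixes w :: "real \<Rightarrow> real"
  assumes w: "integrable lebesgue w" "\<And>t. 0 \<le> w t" and "\<epsilon> > 0"
  shows "\<exists>\<delta>>0. \<forall>Z\<in>lmeasurable. measure lebesgue Z \<le> \<delta> \<longrightarrow> (LINT t|lebesgue. w t * indicator Z t) \<le> \<epsilon>"
proof -
  have wm [measurable]: "w \<in> borel_measurable lebesgue" using w by auto
  have "(\<lambda>M. LINT t|lebesgue. w t * indicator {t. w t > real M} t) \<longlonglongrightarrow> (LINT t|(lebesgue :: real measure). 0)"
  proof (rule integral_dominated_convergence[where w = w])
    show "(\<lambda>t. w t * indicator {t. w t > real M} t) \<in> borel_measurable lebesgue" for M :: nat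
      by measurable
    show "AE t in lebesgue. (\<lambda>M. w t * indicator {t. w t > real M} t) \<longlonglongrightarrow> 0"
    proof (intro AE_I2)
      fix t
      obtain M0 :: nat where "w t < real M0" using reals_Archimedean2 by blast
      then have "\<forall>\<^sub>F M in sequentially. w t * indicator {t. w t > real M} t = 0"
        by (intro eventually_sequentiallyI[of M0]) (auto simp: indicator_def)
      then show "(\<lambda>M. w t * indicator {t. w t > real M} t) \<longlonglongrightarrow> 0" by (rule tendsto_eventually)
    qed
    show "AE t in lebesgue. norm (w t * indicator {t. real M < w t} t) \<le> w t" for M :: nat
      using w(2) by (intro AE_I2) (auto simp: indicator_def)
  qed (use w in auto)
  then have "\<forall>\<^sub>F M in sequentially. (LINT t|lebesgue. w t * indicator {t. w t > real M} t) < \<epsilon> / 2"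
    by (rule order_tendstoD(2)) (use \<open>\<epsilon> > 0\<close> in simp)
  then obtain M :: nat where M: "(LINT t|lebesgue. w t * indicator {t. w t > real M} t) < \<epsilon> / 2"
    by (auto simp: eventually_sequentially)
  define \<delta> where "\<delta> = \<epsilon> / (2 * (real M + 1))"
  have "(LINT t|lebesgue. w t * indicator Z t) \<le> \<epsilon>" if Z: "Z \<in> lmeasurable" "measure lebesgue Z \<le> \<delta>" for Z
  proof -
    have Zm [measurable]: "Z \<in> sets lebesgue" using Z by (simp add: fmeasurableD)
    have iZ: "integrable lebesgue (indicator Z :: real \<Rightarrow> real)" using Z by (simp add: integrable_indicator_iff fmeasurable_def)
    have i1: "integrable lebesgue (\<lambda>t. w t * indicator {t. w t > real M} t)"
      by (rule integrable_mult_bounded[OF w(1), of _ 1]) (auto simp: indicator_def)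
    have "(LINT t|lebesgue. w t * indicator Z t) \<le> (LINT t|lebesgue. w t * indicator {t. w t > real M} t + real M * indicator Z t)"
    proof (rule integral_mono)
      show "integrable lebesgue (\<lambda>t. w t * indicator Z t)"
        by (rule integrable_mult_bounded[OF w(1), of _ 1]) (auto simp: indicator_def)
      show "integrable lebesgue (\<lambda>t. w t * indicator {t. w t > real M} t + real M * indicator Z t)"
        using i1 iZ by simp
    qed (use w(2) in \<open>auto simp: indicator_def not_less\<close>)
    also have "\<dots> = (LINT t|lebesgue. w t * indicator {t. w t > real M} t) + real M * measure lebesgue Z"
      using i1 iZ by (subst Bochner_Integration.integral_add) auto
    also have "real M * measure lebesgue Z \<le> real M * \<delta>" using Z by (intro mult_left_mono) auto
    also have "real M * \<delta> \<le> \<epsilon> / 2" using \<open>\<epsilon> > 0\<close> by (simp add: \<delta>_def field_simps)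
    finally show ?thesis using M by simp
  qed
  moreover have "\<delta> > 0" using \<open>\<epsilon> > 0\<close> by (simp add: \<delta>_def)
  ultimately show ?thesis by blast
qed

section \<open>Smooth square waves\<close>

text \<open>
  A fixed nondecreasing smooth function that is 0 on the left of 0 and 1 on the right of 1.
\<close>
definition smooth_step :: "real \<Rightarrow> real" where
  "smooth_step = (SOME g. (\<forall>k. times_differentiable k g) \<and> (\<forall>t\<le>0. g t = 0) \<and> (\<forall>t\<ge>1. g t = 1) \<and> mono g)"

lemma smooth_step:
  shows times_differentiable_smooth_step: "times_differentiable k smooth_step"
    and smooth_step_0: "t \<le> 0 \<Longrightarrow> smooth_step t = 0"
    and smooth_step_1: "1 \<le> t \<Longrightarrow> smooth_step t = 1"
    and mono_smooth_step: "mono smooth_step"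
proof -
  have "\<exists>g. (\<forall>k. times_differentiable k g) \<and> (\<forall>t\<le>0. g t = 0) \<and> (\<forall>t\<ge>1. g t = 1) \<and> mono g"
    by (rule smooth_step_exists) blast
  from someI_ex[OF this] show "times_differentiable k smooth_step" "t \<le> 0 \<Longrightarrow> smooth_step t = 0"
    "1 \<le> t \<Longrightarrow> smooth_step t = 1" "mono smooth_step"
    unfolding smooth_step_def by blast+
qed

lemma smooth_step_bounds: "0 \<le> smooth_step t" "smooth_step t \<le> 1"
proof -
  show "0 \<le> smooth_step t"
    using smooth_step_0[of "min t 0"] monoD[OF mono_smooth_step, of "min t 0" t] by simp
  show "smooth_step t \<le> 1"
    using smooth_step_1[of "max t 1"] monoD[OF mono_smooth_step, of t "max t 1"] by simp
qed

text \<open>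
  A smooth function with values in \<open>[0, 1]\<close> (for \<open>0 < \<delta> \<le> 1 / 2\<close>) that vanishes outside \<open>(0, 1)\<close> and is 1 on
  \<open>[\<delta>, 1 - \<delta>]\<close>.
\<close>
definition bump :: "real \<Rightarrow> real \<Rightarrow> real" where
  "bump \<delta> t = smooth_step (t / \<delta>) - smooth_step ((t - (1 - \<delta>)) / \<delta>)"

lemma bump_outside: "0 < \<delta> \<Longrightarrow> \<delta> \<le> 1 / 2 \<Longrightarrow> t \<le> 0 \<or> 1 \<le> t \<Longrightarrow> bump \<delta> t = 0"
  by (auto simp: bump_def smooth_step_0 smooth_step_1 divide_le_0_iff)

lemma bump_plateau: "0 < \<delta> \<Longrightarrow> \<delta> \<le> t \<Longrightarrow> t \<le> 1 - \<delta> \<Longrightarrow> bump \<delta> t = 1"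
  by (auto simp: bump_def smooth_step_0 smooth_step_1 divide_le_0_iff)

lemma bump_bounds:
  assumes "0 < \<delta>" "\<delta> \<le> 1 / 2"
  shows "0 \<le> bump \<delta> t" "bump \<delta> t \<le> 1"
proof -
  have "(t - (1 - \<delta>)) / \<delta> \<le> t / \<delta>" using assms by (intro divide_right_mono) auto
  then show "0 \<le> bump \<delta> t" using monoD[OF mono_smooth_step] by (simp add: bump_def)
  show "bump \<delta> t \<le> 1" using smooth_step_bounds[of "t / \<delta>"] smooth_step_bounds[of "(t - (1 - \<delta>)) / \<delta>"]
    by (simp add: bump_def)
qed

text \<open>
  The left end of the \<open>j\<close>-th piece of the partition with the lengths \<open>\<bar>x 0\<bar>, \<bar>x 1\<bar>, \<dots>\<close>.
\<close>
definition breakpoint :: "(nat \<Rightarrow> real) \<Rightarrow> nat \<Rightarrow> real" where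
  "breakpoint x j = (\<Sum>i<j. \<bar>x i\<bar>)"

text \<open>
  On the \<open>j\<close>-th piece the wave is the bump, rescaled to that piece, with the sign of \<open>x j\<close>. It returns to
  0 at both ends of each piece. Hence a piece can shrink to length 0 and disappear without any
  change on its neighbours; a piece with \<open>x j = 0\<close> contributes nothing because \<open>sgn 0 = 0\<close>.
\<close>
definition wave :: "real \<Rightarrow> nat \<Rightarrow> (nat \<Rightarrow> real) \<Rightarrow> real \<Rightarrow> real" where
  "wave \<delta> r x t = (\<Sum>j\<le>r. sgn (x j) * bump \<delta> ((t - breakpoint x j) / \<bar>x j\<bar>))"

text \<open>
  The two ends of all pieces, where the absolute value of the wave may differ from 1.
\<close>
definition wave_bad :: "real \<Rightarrow> nat \<Rightarrow> (nat \<Rightarrow> real) \<Rightarrow> real set" where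
  "wave_bad \<delta> r x = (\<Union>j\<le>r. {breakpoint x j .. breakpoint x j + \<delta> * \<bar>x j\<bar>}
     \<union> {breakpoint x (Suc j) - \<delta> * \<bar>x j\<bar> .. breakpoint x (Suc j)})"

lemma breakpoint_Suc: "breakpoint x (Suc j) = breakpoint x j + \<bar>x j\<bar>"
  by (simp add: breakpoint_def)

lemma breakpoint_mono: "i \<le> j \<Longrightarrow> breakpoint x i \<le> breakpoint x j"
  unfolding breakpoint_def by (intro sum_mono2) auto

lemma times_differentiable_wave: "times_differentiable k (wave \<delta> r x)"
proof -
  have s: "times_differentiable k (\<lambda>t. smooth_step ((t - a) / \<delta>))" for a
    by (intro times_differentiable_affine times_differentiable_smooth_step)
  have "times_differentiable k (\<lambda>t. smooth_step ((t - 0) / \<delta>) + - 1 * smooth_step ((t - (1 - \<delta>)) / \<delta>))"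
    by (intro times_differentiable_add times_differentiable_mult times_differentiable_const s)
  then have "times_differentiable k (bump \<delta>)" by (simp add: bump_def[abs_def])
  then show ?thesis unfolding wave_def[abs_def]
    by (intro times_differentiable_sum times_differentiable_mult times_differentiable_const times_differentiable_affine)
qed

lemma wave_uminus: "wave \<delta> r (\<lambda>i. - x i) t = - wave \<delta> r x t"
  by (simp add: wave_def breakpoint_def sgn_minus sum_negf)

lemma wave_term_zero:
  assumes \<delta>: "0 < \<delta>" "\<delta> \<le> 1 / 2" and t: "t \<le> breakpoint x j \<or> breakpoint x (Suc j) \<le> t"
  shows "sgn (x j) * bump \<delta> ((t - breakpoint x j) / \<bar>x j\<bar>) = 0"
proof (cases "x j = 0")
  case False
  then have "(t - breakpoint x j) / \<bar>x j\<bar> \<le> 0 \<or> 1 \<le> (t - breakpoint x j) / \<bar>x j\<bar>"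
    using t by (auto simp: breakpoint_Suc divide_le_0_iff le_divide_eq)
  then show ?thesis using bump_outside[OF \<delta>] by simp
qed simp

lemma wave_on_piece:
  assumes \<delta>: "0 < \<delta>" "\<delta> \<le> 1 / 2" and j: "j \<le> r" "breakpoint x j < t" "t < breakpoint x (Suc j)"
  shows "wave \<delta> r x t = sgn (x j) * bump \<delta> ((t - breakpoint x j) / \<bar>x j\<bar>)"
proof -
  have "sgn (x i) * bump \<delta> ((t - breakpoint x i) / \<bar>x i\<bar>) = 0" if "i \<noteq> j" for i
  proof (rule wave_term_zero[OF \<delta>])
    show "t \<le> breakpoint x i \<or> breakpoint x (Suc i) \<le> t"
      using breakpoint_mono[of "Suc i" j x] breakpoint_mono[of "Suc j" i x] that j by (cases "i < j") auto
  qed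
  then have "(\<Sum>i\<in>{..r} - {j}. sgn (x i) * bump \<delta> ((t - breakpoint x i) / \<bar>x i\<bar>)) = 0"
    by (intro sum.neutral) auto
  then show ?thesis unfolding wave_def using j(1) by (subst sum.remove[of _ j]) auto
qed

lemma abs_wave_le_1:
  assumes \<delta>: "0 < \<delta>" "\<delta> \<le> 1 / 2"
  shows "\<bar>wave \<delta> r x t\<bar> \<le> 1"
proof (cases "\<exists>j\<le>r. breakpoint x j < t \<and> t < breakpoint x (Suc j)")
  case True
  then obtain j where "j \<le> r" "breakpoint x j < t" "t < breakpoint x (Suc j)" by blast
  then show ?thesis
    using wave_on_piece[OF \<delta>, of j r x t] bump_bounds[OF \<delta>] by (simp add: abs_mult abs_sgn_eq)
next
  case False
  then have "wave \<delta> r x t = 0"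
    unfolding wave_def using wave_term_zero[OF \<delta>] by (intro sum.neutral) (force simp: not_less)
  then show ?thesis by simp
qed

lemma abs_wave_eq_1:
  assumes \<delta>: "0 < \<delta>" "\<delta> \<le> 1 / 2" and x: "x \<in> l1_sphere r" and t: "t \<in> {0..1}" "t \<notin> wave_bad \<delta> r x"
  shows "\<bar>wave \<delta> r x t\<bar> = 1"
proof -
  have last: "breakpoint x (Suc r) = 1"
    using x by (simp add: l1_sphere_def breakpoint_def lessThan_Suc_atMost)
  define j where "j = (LEAST j. t \<le> breakpoint x (Suc j))"
  have tj: "t \<le> breakpoint x (Suc j)" unfolding j_def by (rule LeastI[of _ r]) (use last t in auto)
  have jr: "j \<le> r" unfolding j_def by (rule Least_le) (use last t in auto)
  have tj': "breakpoint x j \<le> t"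
  proof (cases j)
    case 0
    then show ?thesis using t by (simp add: breakpoint_def)
  next
    case (Suc i)
    then show ?thesis using not_less_Least[of i "\<lambda>j. t \<le> breakpoint x (Suc j)"] by (simp add: j_def[symmetric])
  qed
  have 1: "breakpoint x j + \<delta> * \<bar>x j\<bar> < t" and 2: "t < breakpoint x (Suc j) - \<delta> * \<bar>x j\<bar>"
    using t(2) jr tj tj' unfolding wave_bad_def by force+
  have nz: "x j \<noteq> 0" using 1 2 by (auto simp: breakpoint_Suc)
  have "0 \<le> \<delta> * \<bar>x j\<bar>" using \<delta> by simp
  then have *: "breakpoint x j < t" "t < breakpoint x (Suc j)" using 1 2 by linarith+
  have "bump \<delta> ((t - breakpoint x j) / \<bar>x j\<bar>) = 1"
  proof (rule bump_plateau[OF \<delta>(1)])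
    have "0 < \<bar>x j\<bar>" using nz by simp
    then show "\<delta> \<le> (t - breakpoint x j) / \<bar>x j\<bar>" "(t - breakpoint x j) / \<bar>x j\<bar> \<le> 1 - \<delta>"
      using 1 2 by (auto simp only: pos_le_divide_eq pos_divide_le_eq breakpoint_Suc left_diff_distrib)
  qed
  then show ?thesis using wave_on_piece[OF \<delta> jr *] nz by (simp add: abs_mult abs_sgn_eq)
qed

lemma wave_bad_measure:
  assumes \<delta>: "0 < \<delta>" and x: "x \<in> l1_sphere r"
  shows "wave_bad \<delta> r x \<in> lmeasurable" "measure lebesgue (wave_bad \<delta> r x) \<le> 2 * \<delta>"
proof -
  let ?B = "\<lambda>j. {breakpoint x j .. breakpoint x j + \<delta> * \<bar>x j\<bar>}
     \<union> {breakpoint x (Suc j) - \<delta> * \<bar>x j\<bar> .. breakpoint x (Suc j)}"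
  have B: "?B j \<in> lmeasurable" for j by (intro fmeasurable.Un) auto
  show "wave_bad \<delta> r x \<in> lmeasurable" unfolding wave_bad_def
    by (intro fmeasurable.finite_UN B) auto
  have "measure lebesgue (wave_bad \<delta> r x) \<le> (\<Sum>j\<le>r. measure lebesgue (?B j))"
    unfolding wave_bad_def using B by (intro measure_UNION_le) (auto simp: fmeasurableD)
  also have "\<dots> \<le> (\<Sum>j\<le>r. 2 * \<delta> * \<bar>x j\<bar>)"
  proof (rule sum_mono)
    fix j
    have "measure lebesgue (?B j) \<le> measure lebesgue {breakpoint x j .. breakpoint x j + \<delta> * \<bar>x j\<bar>}
        + measure lebesgue {breakpoint x (Suc j) - \<delta> * \<bar>x j\<bar> .. breakpoint x (Suc j)}"
      by (rule measure_Un_le) auto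
    then show "measure lebesgue (?B j) \<le> 2 * \<delta> * \<bar>x j\<bar>" using \<delta> by simp
  qed
  also have "\<dots> = 2 * \<delta>" using x by (simp add: l1_sphere_def sum_distrib_left[symmetric])
  finally show "measure lebesgue (wave_bad \<delta> r x) \<le> 2 * \<delta>" .
qed

lemma isCont_bump: "isCont (bump \<delta>) t"
proof -
  have "isCont smooth_step t" for t
    using times_differentiable_smooth_step[of 1] by (auto intro: DERIV_isCont)
  note cont = this
  have "isCont (\<lambda>t. smooth_step (t / \<delta>)) t"
    by (rule isCont_o2[OF _ cont]) (cases "\<delta> = 0"; simp)
  moreover have "isCont (\<lambda>t. smooth_step ((t - (1 - \<delta>)) / \<delta>)) t"
    by (rule isCont_o2[OF _ cont]) (cases "\<delta> = 0"; simp)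
  ultimately show ?thesis unfolding bump_def[abs_def] by (rule continuous_diff)
qed

text \<open>
  The wave depends continuously on \<open>x\<close> away from the finitely many breakpoints, also when pieces
  vanish in the limit.
\<close>
lemma wave_tendsto:
  assumes \<delta>: "0 < \<delta>" "\<delta> \<le> 1 / 2" and X: "\<And>j. (\<lambda>k. X k j) \<longlonglongrightarrow> x j"
    and t: "t \<notin> breakpoint x ` {..r}"
  shows "(\<lambda>k. wave \<delta> r (X k) t) \<longlonglongrightarrow> wave \<delta> r x t"
  unfolding wave_def
proof (rule tendsto_sum)
  fix j assume j: "j \<in> {..r}"
  have bp: "(\<lambda>k. breakpoint (X k) j) \<longlonglongrightarrow> breakpoint x j" for j
    unfolding breakpoint_def by (intro tendsto_intros X)
  show "(\<lambda>k. sgn (X k j) * bump \<delta> ((t - breakpoint (X k) j) / \<bar>X k j\<bar>))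
    \<longlonglongrightarrow> sgn (x j) * bump \<delta> ((t - breakpoint x j) / \<bar>x j\<bar>)"
  proof (cases "x j = 0")
    case False
    then show ?thesis
      by (intro tendsto_intros isCont_tendsto_compose[OF isCont_bump] X bp) auto
  next
    case True
    have "t < breakpoint x j \<or> t > breakpoint x (Suc j)" using t j True by (auto simp: breakpoint_Suc)
    then have "\<forall>\<^sub>F k in sequentially. t \<le> breakpoint (X k) j \<or> breakpoint (X k) (Suc j) \<le> t"
    proof
      assume "t < breakpoint x j"
      from order_tendstoD(1)[OF bp this] show ?thesis by eventually_elim auto
    next
      assume "t > breakpoint x (Suc j)"
      from order_tendstoD(2)[OF bp this] show ?thesis by eventually_elim auto
    qed
    then have "\<forall>\<^sub>F k in sequentially. sgn (X k j) * bump \<delta> ((t - breakpoint (X k) j) / \<bar>X k j\<bar>) = 0"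
      by eventually_elim (rule wave_term_zero[OF \<delta>])
    then show ?thesis using True by (simp add: tendsto_eventually)
  qed
qed

section \<open>Phases that annihilate independent functions\<close>

lemma abs_cos_diff_le: "\<bar>cos u - cos v\<bar> \<le> \<bar>u - v\<bar>" for u v :: real
  using field_differentiable_bound[of UNIV cos "\<lambda>t. - sin t" 1 u v]
  by (auto intro!: derivative_eq_intros)

lemma sin_near_id:
  fixes a b :: real
  assumes "\<bar>a\<bar> \<le> \<kappa>" "\<bar>b\<bar> \<le> \<kappa>"
  shows "\<bar>(a - b) - (sin a - sin b)\<bar> \<le> \<kappa> * \<bar>a - b\<bar>"
proof -
  have "norm ((a - sin a) - (b - sin b)) \<le> \<kappa> * norm (a - b)"
  proof (rule field_differentiable_bound[of "{-\<kappa>..\<kappa>}" "\<lambda>t. t - sin t" "\<lambda>t. 1 - cos t"])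
    fix z assume z: "z \<in> {-\<kappa>..\<kappa>}"
    show "((\<lambda>t. t - sin t) has_field_derivative 1 - cos z) (at z within {-\<kappa>..\<kappa>})"
      by (auto intro!: derivative_eq_intros)
    show "norm (1 - cos z) \<le> \<kappa>"
      using abs_cos_diff_le[of 0 z] z by auto
  qed (use assms in auto)
  then show ?thesis by (simp add: algebra_simps)
qed

text \<open>
  Where the wave has the value \<open>s\<close> with \<open>\<bar>s\<bar> = 1\<close>, the cosine of the phase equals \<open>sin a\<close>, which is close to
  the correction \<open>a\<close>; elsewhere only a Lipschitz bound is needed.
\<close>
lemma cos_near_linear:
  fixes s a b \<kappa> :: real
  assumes "\<bar>s\<bar> \<le> 1" "\<bar>a\<bar> \<le> \<kappa>" "\<bar>b\<bar> \<le> \<kappa>"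
  shows "\<bar>(a - b) - (cos (s * (pi / 2 - a)) - cos (s * (pi / 2 - b)))\<bar>
    \<le> \<bar>a - b\<bar> * ((if \<bar>s\<bar> = 1 then 0 else 2) + \<kappa>)"
proof (cases "\<bar>s\<bar> = 1")
  case True
  have "cos (s * (pi / 2 - c)) = sin c" for c
  proof -
    consider "s = 1" | "s = - 1" using True by linarith
    then show ?thesis
    proof cases
      case 1 then show ?thesis by (simp add: cos_diff)
    next
      case 2
      have "cos (s * (pi / 2 - c)) = cos (- (pi / 2 - c))" by (simp add: 2)
      then show ?thesis by (simp only: cos_minus) (simp add: cos_diff)
    qed
  qed
  then show ?thesis using sin_near_id[OF assms(2,3)] True by (simp add: mult.commute)
next
  case False
  have "\<bar>cos (s * (pi / 2 - a)) - cos (s * (pi / 2 - b))\<bar> \<le> \<bar>s\<bar> * \<bar>a - b\<bar>"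
    using abs_cos_diff_le[of "s * (pi / 2 - a)" "s * (pi / 2 - b)"]
    by (simp add: abs_mult[symmetric] algebra_simps abs_minus_commute)
  also have "\<dots> \<le> 1 * \<bar>a - b\<bar>" using assms(1) by (intro mult_right_mono) auto
  finally have le: "\<bar>cos (s * (pi / 2 - a)) - cos (s * (pi / 2 - b))\<bar> \<le> \<bar>a - b\<bar>" by simp
  have "\<bar>(a - b) - (cos (s * (pi / 2 - a)) - cos (s * (pi / 2 - b)))\<bar>
      \<le> \<bar>a - b\<bar> + \<bar>cos (s * (pi / 2 - a)) - cos (s * (pi / 2 - b))\<bar>"
    by (rule abs_triangle_ineq4)
  also have "\<dots> \<le> \<bar>a - b\<bar> + \<bar>a - b\<bar>" using le by (rule add_left_mono)
  also have "\<dots> \<le> \<bar>a - b\<bar> * (2 + \<kappa>)"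
  proof -
    have "0 \<le> \<kappa>" using assms(2) by linarith
    then show ?thesis using mult_left_mono[of 2 "2 + \<kappa>" "\<bar>a - b\<bar>"] by simp
  qed
  finally show ?thesis using False by simp
qed

text \<open>
  The angle measured from the imaginary axis: the final unimodular function is
  \<open>exp (\<i> * (pi / 2 - phase))\<close>, with real part \<open>sin phase\<close> and imaginary part \<open>cos phase\<close>. For \<open>p = 0\<close> it is the
  imaginary unit at the ends of each piece and \<open>sgn (x j)\<close> in the middle of the \<open>j\<close>-th piece. The
  polynomial \<open>p\<close> is a small correction. The phase is odd in \<open>x\<close>.
\<close>
definition phase :: "real \<Rightarrow> nat \<Rightarrow> (nat \<Rightarrow> real) \<Rightarrow> real poly \<Rightarrow> real \<Rightarrow> real" where
  "phase \<delta> r x p t = wave \<delta> r x t * (pi / 2 - poly p t)"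

lemma continuous_phase: "continuous_on UNIV (phase \<delta> r x p)"
proof -
  have "continuous_on UNIV (wave \<delta> r x)"
    using times_differentiable_wave[of 1 \<delta> r x] by (auto intro!: continuous_at_imp_continuous_on DERIV_isCont)
  then show ?thesis unfolding phase_def[abs_def] by (intro continuous_intros)
qed

lemma phase_uminus: "phase \<delta> r (\<lambda>i. - x i) p t = - phase \<delta> r x p t"
  by (simp add: phase_def wave_uminus)

lemma phase_integral_tendsto:
  fixes R \<phi> :: "real \<Rightarrow> real" and p :: "nat \<Rightarrow> real poly"
  assumes \<delta>: "0 < \<delta>" "\<delta> \<le> 1 / 2" and X: "\<And>j. (\<lambda>k. X k j) \<longlonglongrightarrow> x j"
    and p: "\<And>t. (\<lambda>k. poly (p k) t) \<longlonglongrightarrow> poly p' t"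
    and R: "integrable lebesgue R" "\<And>t. t \<notin> {0..1} \<Longrightarrow> R t = 0"
    and \<phi>: "continuous_on UNIV \<phi>" "\<And>u. \<bar>\<phi> u\<bar> \<le> 1"
  shows "(\<lambda>k. LINT t|lebesgue. R t * \<phi> (phase \<delta> r (X k) (p k) t))
    \<longlonglongrightarrow> (LINT t|lebesgue. R t * \<phi> (phase \<delta> r x p' t))"
proof (rule integral_dominated_convergence[where w = "\<lambda>t. \<bar>R t\<bar>"])
  have int: "integrable lebesgue (\<lambda>t. R t * \<phi> (phase \<delta> r x p t))" for x p
    by (intro integrable_mult_continuous R continuous_on_compose2[OF \<phi>(1) continuous_phase]) simp_all
  show "(\<lambda>t. R t * \<phi> (phase \<delta> r x p' t)) \<in> borel_measurable lebesgue"
    "(\<lambda>t. R t * \<phi> (phase \<delta> r (X k) (p k) t)) \<in> borel_measurable lebesgue" for k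
    using int by (auto intro: borel_measurable_integrable)
  show "integrable lebesgue (\<lambda>t. \<bar>R t\<bar>)" using R(1) by simp
  have "negligible (breakpoint x ` {..r})" by (intro negligible_finite) simp
  then have "AE t in lebesgue. t \<notin> breakpoint x ` {..r}"
    by (intro AE_not_in) (simp add: negligible_iff_null_sets)
  then show "AE t in lebesgue. (\<lambda>k. R t * \<phi> (phase \<delta> r (X k) (p k) t)) \<longlonglongrightarrow> R t * \<phi> (phase \<delta> r x p' t)"
  proof eventually_elim
    case (elim t)
    have "(\<lambda>k. phase \<delta> r (X k) (p k) t) \<longlonglongrightarrow> phase \<delta> r x p' t"
      unfolding phase_def by (intro tendsto_intros wave_tendsto[OF \<delta> X elim] p)
    moreover have "isCont \<phi> u" for u using \<phi>(1) by (simp add: continuous_on_eq_continuous_at)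
    ultimately show ?case by (intro tendsto_intros isCont_tendsto_compose[of _ \<phi>])
  qed
  have "\<bar>R t * \<phi> u\<bar> \<le> \<bar>R t\<bar>" for t u
    using mult_left_mono[OF \<phi>(2)[of u], of "\<bar>R t\<bar>"] by (simp add: abs_mult)
  then show "AE t in lebesgue. norm (R t * \<phi> (phase \<delta> r (X k) (p k) t)) \<le> \<bar>R t\<bar>" for k by simp
qed

lemma poly_bounded_on_unit_interval:
  fixes q :: "nat \<Rightarrow> real poly"
  obtains K where "K \<ge> 1" "\<And>j t. j < r \<Longrightarrow> t \<in> {0..1} \<Longrightarrow> \<bar>poly (q j) t\<bar> \<le> K"
proof -
  have "\<exists>K. \<forall>t\<in>{0..1}. \<bar>poly (q j) t\<bar> \<le> K" for j
  proof -
    have "compact (poly (q j) ` {0..1})" by (intro compact_continuous_image continuous_intros) auto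
    then have "bounded (poly (q j) ` {0..1})" by (rule compact_imp_bounded)
    then show ?thesis unfolding bounded_iff by (metis imageI real_norm_def)
  qed
  then obtain C where C: "\<And>j t. t \<in> {0..1} \<Longrightarrow> \<bar>poly (q j) t\<bar> \<le> C j" by metis
  show ?thesis
  proof (rule that[of "1 + (\<Sum>j<r. \<bar>C j\<bar>)"])
    fix j t assume "j < r" "t \<in> {0..1::real}"
    then have "\<bar>poly (q j) t\<bar> \<le> \<bar>C j\<bar>" using C[of t j] by linarith
    moreover have "\<bar>C j\<bar> \<le> (\<Sum>j<r. \<bar>C j\<bar>)" using \<open>j < r\<close> by (intro member_le_sum) auto
    ultimately show "\<bar>poly (q j) t\<bar> \<le> 1 + (\<Sum>j<r. \<bar>C j\<bar>)" by linarith
  qed (simp add: sum_nonneg)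
qed

lemma pderiv_sum: "pderiv (\<Sum>j\<in>A. f j) = (\<Sum>j\<in>A. pderiv (f j))"
  by (induction A rule: infinite_finite_induct) (auto simp: pderiv_add)

text \<open>
  The case of functions with a dual family of polynomials. For each \<open>x\<close> a small correction \<open>Y x\<close>, given
  by coordinates with respect to the dual polynomials, makes all cosine integrals vanish, by the
  contraction principle. By the contraction estimate it is continuous in \<open>x\<close>, and it is the same
  for \<open>x\<close> and \<open>- x\<close>. So the sine integrals are odd and continuous on the \<open>r\<close>-dimensional sphere,
  and they vanish simultaneously somewhere.
\<close>
lemma annihilating_phase_independent:
  fixes R :: "nat \<Rightarrow> real \<Rightarrow> real" and q :: "nat \<Rightarrow> real poly"
  assumes R: "\<And>i. i < r \<Longrightarrow> integrable lebesgue (R i)" "\<And>i t. i < r \<Longrightarrow> t \<notin> {0..1} \<Longrightarrow> R i t = 0"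
    and q: "\<And>i j. i < r \<Longrightarrow> j < r \<Longrightarrow> (LINT t|lebesgue. R i t * poly (q j) t) = of_bool (i = j)"
  obtains x \<delta> p where "0 < \<delta>" "\<delta> \<le> 1 / 2" "x \<in> l1_sphere r"
    "\<And>t. t \<in> {0..1} \<Longrightarrow> \<bar>poly p t\<bar> \<le> 1 / 2" "\<And>t. t \<in> {0..1} \<Longrightarrow> \<bar>poly (pderiv p) t\<bar> \<le> 1"
    "\<And>i. i < r \<Longrightarrow> (LINT t|lebesgue. R i t * cos (phase \<delta> r x p t)) = 0"
    "\<And>i. i < r \<Longrightarrow> (LINT t|lebesgue. R i t * sin (phase \<delta> r x p t)) = 0"
proof -
  define N where "N y = (\<Sum>i<r. \<bar>y i\<bar>)" for y :: "nat \<Rightarrow> real"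
  have N_nonneg: "0 \<le> N y" for y by (simp add: N_def sum_nonneg)
  obtain K1 K2 where K12: "K1 \<ge> 1" "\<And>j t. j < r \<Longrightarrow> t \<in> {0..1} \<Longrightarrow> \<bar>poly (q j) t\<bar> \<le> K1"
    "K2 \<ge> 1" "\<And>j t. j < r \<Longrightarrow> t \<in> {0..1} \<Longrightarrow> \<bar>poly (pderiv (q j)) t\<bar> \<le> K2"
    using poly_bounded_on_unit_interval[of r q] poly_bounded_on_unit_interval[of r "\<lambda>j. pderiv (q j)"] by metis
  define K where "K = max K1 K2"
  have K: "K \<ge> 1" "\<And>j t. j < r \<Longrightarrow> t \<in> {0..1} \<Longrightarrow> \<bar>poly (q j) t\<bar> \<le> K"
    "\<And>j t. j < r \<Longrightarrow> t \<in> {0..1} \<Longrightarrow> \<bar>poly (pderiv (q j)) t\<bar> \<le> K"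
    using K12 by (auto simp: K_def le_max_iff_disj)
  define w where "w t = (\<Sum>i<r. \<bar>R i t\<bar>)" for t
  have w: "integrable lebesgue w" "\<And>t. 0 \<le> w t" unfolding w_def using R(1) by (auto intro!: Bochner_Integration.integrable_sum sum_nonneg)
  define W where "W = (LINT t|lebesgue. w t)"
  have W: "W \<ge> 0" unfolding W_def using w(2) by simp
  \<comment> \<open>The contraction constant below is \<open>2 * K * \<epsilon> + K * \<kappa> * W\<close>, and both summands are at most \<open>1 / 4\<close>.
     The corrections range over the ball of radius \<open>\<eta>\<close>, on which they are bounded by \<open>\<kappa>\<close>.\<close>
  define \<kappa> where "\<kappa> = 1 / (4 * K * (W + 1))"
  define \<eta> where "\<eta> = \<kappa> / K"
  define \<epsilon> where "\<epsilon> = min (1 / (8 * K)) (\<eta> / 2)"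
  have \<kappa>: "\<kappa> > 0" using K(1) W by (simp add: \<kappa>_def)
  have "K * \<kappa> * W = W / (4 * (W + 1))" using K(1) by (simp add: \<kappa>_def)
  also have "\<dots> \<le> 1 / 4" using W by (simp add: divide_le_eq)
  finally have K\<kappa>W: "K * \<kappa> * W \<le> 1 / 4" .
  have "1 \<le> K * (W + 1)" using mult_mono[of 1 K 1 "W + 1"] K(1) W by simp
  then have \<kappa>': "\<kappa> \<le> 1 / 4" unfolding \<kappa>_def using K(1) W by (simp add: field_simps)
  have \<eta>: "\<eta> > 0" "K * \<eta> = \<kappa>" using \<kappa> K(1) by (auto simp: \<eta>_def)
  have \<epsilon>: "\<epsilon> > 0" "2 * K * \<epsilon> \<le> 1 / 4" "\<epsilon> \<le> \<eta> / 2"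
  proof -
    show "\<epsilon> > 0" "\<epsilon> \<le> \<eta> / 2" using K(1) \<eta> by (auto simp: \<epsilon>_def)
    have "2 * K * \<epsilon> \<le> 2 * K * (1 / (8 * K))" using K(1) by (intro mult_left_mono) (auto simp: \<epsilon>_def)
    then show "2 * K * \<epsilon> \<le> 1 / 4" using K(1) by simp
  qed
  obtain \<delta>0 where \<delta>0: "\<delta>0 > 0"
    "\<And>Z. Z \<in> lmeasurable \<Longrightarrow> measure lebesgue Z \<le> \<delta>0 \<Longrightarrow> (LINT t|lebesgue. w t * indicator Z t) \<le> \<epsilon>"
    using small_integral_small_sets[OF w \<epsilon>(1)] by blast
  define \<delta> where "\<delta> = min (1 / 2) (\<delta>0 / 2)"
  have \<delta>: "0 < \<delta>" "\<delta> \<le> 1 / 2" "2 * \<delta> \<le> \<delta>0" using \<delta>0(1) by (auto simp: \<delta>_def)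
  define Q where "Q y = (\<Sum>j<r. smult (y j) (q j))" for y :: "nat \<Rightarrow> real"
  have Q_diff: "poly (Q y) t - poly (Q y') t = (\<Sum>j<r. (y j - y' j) * poly (q j) t)" for y y' t
    by (simp add: Q_def poly_sum sum_subtractf left_diff_distrib)
  have Q_diff_le: "\<bar>poly (Q y) t - poly (Q y') t\<bar> \<le> K * N (\<lambda>i. y i - y' i)" if t: "t \<in> {0..1}" for y y' t
  proof -
    have "\<bar>poly (Q y) t - poly (Q y') t\<bar> \<le> (\<Sum>j<r. \<bar>(y j - y' j) * poly (q j) t\<bar>)"
      unfolding Q_diff by (rule sum_abs)
    also have "\<dots> \<le> (\<Sum>j<r. K * \<bar>y j - y' j\<bar>)"
      using K(2)[OF _ t] by (intro sum_mono) (auto simp: abs_mult mult.commute[of K] intro: mult_left_mono)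
    finally show ?thesis by (simp add: N_def sum_distrib_left)
  qed
  have Q0: "Q (\<lambda>i. 0) = 0" by (simp add: Q_def)
  have Q_le: "\<bar>poly (Q y) t\<bar> \<le> \<kappa>" if "t \<in> {0..1}" "N y \<le> \<eta>" for y t
    using Q_diff_le[OF that(1), of y "\<lambda>i. 0"] mult_left_mono[OF that(2), of K] \<eta>(2) K(1) by (simp add: Q0)
  have Q'_le: "\<bar>poly (pderiv (Q y)) t\<bar> \<le> \<kappa>" if t: "t \<in> {0..1}" and y: "N y \<le> \<eta>" for y t
  proof -
    have "\<bar>poly (pderiv (Q y)) t\<bar> \<le> (\<Sum>j<r. \<bar>y j * poly (pderiv (q j)) t\<bar>)"
      unfolding Q_def pderiv_sum pderiv_smult poly_sum poly_smult by (rule sum_abs)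
    also have "\<dots> \<le> (\<Sum>j<r. K * \<bar>y j\<bar>)"
      using K(3)[OF _ t] by (intro sum_mono) (auto simp: abs_mult mult.commute[of K] intro: mult_left_mono)
    also have "\<dots> = K * N y" by (simp add: N_def sum_distrib_left)
    also have "\<dots> \<le> \<kappa>" using mult_left_mono[OF y, of K] \<eta>(2) K(1) by simp
    finally show ?thesis .
  qed
  have R_int: "integrable lebesgue (\<lambda>t. R i t * h t)" if "i < r" "continuous_on UNIV h" for i h
    using integrable_mult_continuous[of "R i" h] R that by blast
  have cont: "continuous_on UNIV (\<lambda>t. cos (phase \<delta> r x p t))" "continuous_on UNIV (\<lambda>t. sin (phase \<delta> r x p t))"
    "continuous_on UNIV (poly p)" for x p
    by (intro continuous_intros continuous_phase)+
  have R_Q: "(LINT t|lebesgue. R i t * poly (Q y) t) = y i" if i: "i < r" for i y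
  proof -
    have "(LINT t|lebesgue. R i t * poly (Q y) t) = (LINT t|lebesgue. (\<Sum>j<r. y j * (R i t * poly (q j) t)))"
      by (simp add: Q_def poly_sum sum_distrib_left mult_ac)
    also have "\<dots> = (\<Sum>j<r. (LINT t|lebesgue. y j * (R i t * poly (q j) t)))"
      by (intro Bochner_Integration.integral_sum integrable_mult_right R_int i cont)
    also have "\<dots> = (\<Sum>j<r. if i = j then y j else 0)"
      by (intro sum.cong) (auto simp: q i)
    finally show ?thesis using i by simp
  qed
  \<comment> \<open>\<open>G\<close> is even and \<open>H\<close> is odd in \<open>x\<close>; the zeros of \<open>G x\<close> are the fixed points of \<open>T x\<close>\<close>
  define G where "G x y i = (LINT t|lebesgue. R i t * cos (phase \<delta> r x (Q y) t))" for x y i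
  define H where "H x y i = (LINT t|lebesgue. R i t * sin (phase \<delta> r x (Q y) t))" for x y i
  define T where "T x y i = y i - G x y i" for x y i
  have contr: "N (\<lambda>i. T x y i - T x y' i) \<le> 1 / 2 * N (\<lambda>i. y i - y' i)"
    if x: "x \<in> l1_sphere r" and y: "N y \<le> \<eta>" "N y' \<le> \<eta>" for x y y'
  proof -
    define Z where "Z = wave_bad \<delta> r x"
    have Z: "Z \<in> lmeasurable" "(LINT t|lebesgue. w t * indicator Z t) \<le> \<epsilon>"
      using wave_bad_measure[OF \<delta>(1) x] \<delta>(3) \<delta>0(2)[of Z] by (auto simp: Z_def)
    have Zm [measurable]: "Z \<in> sets lebesgue" using Z(1) by (rule fmeasurableD)
    define n where "n = N (\<lambda>i. y i - y' i)"
    define d where "d t = (poly (Q y) t - poly (Q y') t) - (cos (phase \<delta> r x (Q y) t) - cos (phase \<delta> r x (Q y') t))" for t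
    have d_cont: "continuous_on UNIV d" unfolding d_def by (intro continuous_intros continuous_phase)
    have d_le: "\<bar>d t\<bar> \<le> K * n * (2 * indicator Z t + \<kappa>)" if t: "t \<in> {0..1}" for t
    proof -
      have "\<bar>d t\<bar> \<le> \<bar>poly (Q y) t - poly (Q y') t\<bar> * ((if \<bar>wave \<delta> r x t\<bar> = 1 then 0 else 2) + \<kappa>)"
        unfolding d_def phase_def by (intro cos_near_linear abs_wave_le_1 \<delta> Q_le t y)
      also have "\<dots> \<le> (K * n) * (2 * indicator Z t + \<kappa>)"
      proof (rule mult_mono)
        show "\<bar>poly (Q y) t - poly (Q y') t\<bar> \<le> K * n" unfolding n_def by (rule Q_diff_le[OF t])
        show "(if \<bar>wave \<delta> r x t\<bar> = 1 then 0 else 2) + \<kappa> \<le> 2 * indicator Z t + \<kappa>"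
          using abs_wave_eq_1[OF \<delta>(1,2) x t] by (auto simp: Z_def indicator_def)
      qed (use K(1) \<kappa> N_nonneg in \<open>auto simp: n_def\<close>)
      finally show ?thesis .
    qed
    have wZ: "integrable lebesgue (\<lambda>t. w t * indicator Z t)"
      by (rule integrable_mult_bounded[OF w(1), of _ 1]) (auto simp: indicator_def)
    have "N (\<lambda>i. T x y i - T x y' i) = (\<Sum>i<r. \<bar>LINT t|lebesgue. R i t * d t\<bar>)"
      unfolding N_def
    proof (rule sum.cong)
      fix i assume "i \<in> {..<r}"
      then have i: "i < r" by simp
      have "T x y i - T x y' i = ((LINT t|lebesgue. R i t * poly (Q y) t) - (LINT t|lebesgue. R i t * poly (Q y') t))
         - (G x y i - G x y' i)" using R_Q[OF i] by (simp add: T_def)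
      also have "\<dots> = (LINT t|lebesgue. (R i t * poly (Q y) t - R i t * poly (Q y') t)
         - (R i t * cos (phase \<delta> r x (Q y) t) - R i t * cos (phase \<delta> r x (Q y') t)))"
        unfolding G_def by (simp add: Bochner_Integration.integral_diff Bochner_Integration.integrable_diff R_int[OF i] cont)
      also have "\<dots> = (LINT t|lebesgue. R i t * d t)" by (simp add: d_def algebra_simps)
      finally show "\<bar>T x y i - T x y' i\<bar> = \<bar>LINT t|lebesgue. R i t * d t\<bar>" by simp
    qed simp
    also have "\<dots> \<le> (\<Sum>i<r. (LINT t|lebesgue. \<bar>R i t * d t\<bar>))"
      using integral_norm_bound[of lebesgue "\<lambda>t. R _ t * d t"] by (intro sum_mono) simp
    also have "\<dots> = (LINT t|lebesgue. (\<Sum>i<r. \<bar>R i t * d t\<bar>))"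
      using R_int[OF _ d_cont] by (intro Bochner_Integration.integral_sum[symmetric]) auto
    also have "\<dots> \<le> (LINT t|lebesgue. K * n * (2 * (w t * indicator Z t) + \<kappa> * w t))"
    proof (rule integral_mono)
      show "integrable lebesgue (\<lambda>t. \<Sum>i<r. \<bar>R i t * d t\<bar>)"
        using R_int[OF _ d_cont] by (intro Bochner_Integration.integrable_sum) auto
      show "integrable lebesgue (\<lambda>t. K * n * (2 * (w t * indicator Z t) + \<kappa> * w t))"
        using wZ w(1) by simp
      show "(\<Sum>i<r. \<bar>R i t * d t\<bar>) \<le> K * n * (2 * (w t * indicator Z t) + \<kappa> * w t)" for t
      proof (cases "t \<in> {0..1}")
        case True
        have "(\<Sum>i<r. \<bar>R i t * d t\<bar>) = w t * \<bar>d t\<bar>" by (simp add: w_def abs_mult sum_distrib_right)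
        also have "\<dots> \<le> w t * (K * n * (2 * indicator Z t + \<kappa>))" using d_le[OF True] w(2) by (rule mult_left_mono)
        finally show ?thesis by (simp add: algebra_simps)
      next
        case False
        then show ?thesis using R(2) by (simp add: w_def)
      qed
    qed
    also have "\<dots> = K * n * (2 * (LINT t|lebesgue. w t * indicator Z t) + \<kappa> * W)"
      using wZ w(1) by (simp add: W_def)
    also have "\<dots> \<le> K * n * (2 * \<epsilon> + \<kappa> * W)"
      using Z(2) K(1) N_nonneg[of "\<lambda>i. y i - y' i"] by (intro mult_left_mono) (auto simp: n_def)
    also have "\<dots> = n * (2 * K * \<epsilon> + K * \<kappa> * W)" by (simp add: algebra_simps)
    also have "\<dots> \<le> n * (1 / 4 + 1 / 4)"
      using \<epsilon>(2) K\<kappa>W N_nonneg[of "\<lambda>i. y i - y' i"] by (intro mult_left_mono) (auto simp: n_def)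
    finally show ?thesis by (simp add: n_def)
  qed
  have T0: "N (T x (\<lambda>i. 0)) \<le> \<eta> / 2" if x: "x \<in> l1_sphere r" for x
  proof -
    define Z where "Z = wave_bad \<delta> r x"
    have Z: "Z \<in> lmeasurable" "(LINT t|lebesgue. w t * indicator Z t) \<le> \<epsilon>"
      using wave_bad_measure[OF \<delta>(1) x] \<delta>(3) \<delta>0(2)[of Z] by (auto simp: Z_def)
    have Zm [measurable]: "Z \<in> sets lebesgue" using Z(1) by (rule fmeasurableD)
    let ?c = "\<lambda>t. cos (phase \<delta> r x 0 t)"
    have "N (T x (\<lambda>i. 0)) = (\<Sum>i<r. \<bar>LINT t|lebesgue. R i t * ?c t\<bar>)"
      by (simp add: N_def T_def G_def Q0)
    also have "\<dots> \<le> (\<Sum>i<r. (LINT t|lebesgue. \<bar>R i t * ?c t\<bar>))"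
      using integral_norm_bound[of lebesgue "\<lambda>t. R _ t * ?c t"] by (intro sum_mono) simp
    also have "\<dots> = (LINT t|lebesgue. (\<Sum>i<r. \<bar>R i t * ?c t\<bar>))"
      using R_int[OF _ cont(1)] by (intro Bochner_Integration.integral_sum[symmetric]) auto
    also have "\<dots> \<le> (LINT t|lebesgue. w t * indicator Z t)"
    proof (rule integral_mono)
      show "integrable lebesgue (\<lambda>t. \<Sum>i<r. \<bar>R i t * ?c t\<bar>)"
        using R_int[OF _ cont(1)] by (intro Bochner_Integration.integrable_sum) auto
      show "integrable lebesgue (\<lambda>t. w t * indicator Z t)"
        by (rule integrable_mult_bounded[OF w(1), of _ 1]) (auto simp: indicator_def)
      show "(\<Sum>i<r. \<bar>R i t * ?c t\<bar>) \<le> w t * indicator Z t" for t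
      proof (cases "t \<in> {0..1}")
        case True
        have "\<bar>?c t\<bar> \<le> indicator Z t"
        proof (cases "t \<in> Z")
          case False
          then have "\<bar>wave \<delta> r x t\<bar> = 1" using abs_wave_eq_1[OF \<delta>(1,2) x True] by (simp add: Z_def)
          then have "wave \<delta> r x t = 1 \<or> wave \<delta> r x t = - 1" by linarith
          then show ?thesis by (auto simp: phase_def)
        qed simp
        from mult_left_mono[OF this w(2)[of t]] show ?thesis
          by (simp add: w_def abs_mult sum_distrib_right)
      next
        case False
        then show ?thesis using R(2) by (simp add: w_def)
      qed
    qed
    also have "\<dots> \<le> \<eta> / 2" using Z(2) \<epsilon>(3) by linarith
    finally show ?thesis .
  qed
  define good where "good x y \<longleftrightarrow> N y \<le> \<eta> \<and> (\<forall>i<r. G x y i = 0)" for x y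
  \<comment> \<open>the choice depends only on the predicate \<open>good x\<close>, which is the same for \<open>- x\<close>\<close>
  define Y where "Y x = (SOME y. good x y)" for x
  have Y: "good x (Y x)" if x: "x \<in> l1_sphere r" for x
  proof -
    have "\<exists>y. N y \<le> \<eta> \<and> (\<forall>i<r. T x y i = y i)"
      unfolding N_def by (rule sum_contraction_fixpoint) (use contr[OF x] T0[OF x] in \<open>simp_all add: N_def\<close>)
    then have "\<exists>y. good x y" by (auto simp: good_def T_def)
    then show ?thesis unfolding Y_def by (rule someI_ex)
  qed
  have Y_even: "Y (\<lambda>i. - x i) = Y x" for x
    by (simp add: Y_def good_def G_def phase_uminus)
  have Y_tendsto: "(\<lambda>k. Y (X k) j) \<longlonglongrightarrow> Y x j"
    if X: "\<And>k. X k \<in> l1_sphere r" "x \<in> l1_sphere r" "\<And>j. (\<lambda>k. X k j) \<longlonglongrightarrow> x j" and j: "j < r" for X x j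
  proof -
    have "(\<lambda>k. G (X k) (Y x) i) \<longlonglongrightarrow> 0" if i: "i < r" for i
    proof -
      have "(\<lambda>k. G (X k) (Y x) i) \<longlonglongrightarrow> G x (Y x) i"
        unfolding G_def by (intro phase_integral_tendsto \<delta> X(3) R i continuous_intros) auto
      then show ?thesis using Y[OF X(2)] i by (simp add: good_def)
    qed
    then have "(\<lambda>k. 2 * (\<Sum>i<r. \<bar>G (X k) (Y x) i\<bar>)) \<longlonglongrightarrow> 2 * (\<Sum>i<r. \<bar>0\<bar>)"
      by (intro tendsto_intros) auto
    then have lim: "(\<lambda>k. 2 * (\<Sum>i<r. \<bar>G (X k) (Y x) i\<bar>)) \<longlonglongrightarrow> 0" by simp
    have "\<bar>Y (X k) j - Y x j\<bar> \<le> 2 * (\<Sum>i<r. \<bar>G (X k) (Y x) i\<bar>)" for k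
    proof -
      let ?n = "N (\<lambda>i. Y (X k) i - Y x i)"
      have g: "N (Y (X k)) \<le> \<eta>" "N (Y x) \<le> \<eta>" "\<And>i. i < r \<Longrightarrow> G (X k) (Y (X k)) i = 0"
        using Y X(1,2) by (auto simp: good_def)
      have "?n \<le> (\<Sum>i<r. \<bar>T (X k) (Y (X k)) i - T (X k) (Y x) i\<bar> + \<bar>G (X k) (Y x) i\<bar>)"
        unfolding N_def by (intro sum_mono) (auto simp: T_def g(3))
      also have "\<dots> = N (\<lambda>i. T (X k) (Y (X k)) i - T (X k) (Y x) i) + (\<Sum>i<r. \<bar>G (X k) (Y x) i\<bar>)"
        by (simp add: N_def sum.distrib)
      also have "\<dots> \<le> 1 / 2 * ?n + (\<Sum>i<r. \<bar>G (X k) (Y x) i\<bar>)"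
        using contr[OF X(1) g(1,2)] by simp
      finally have "?n \<le> 2 * (\<Sum>i<r. \<bar>G (X k) (Y x) i\<bar>)" by simp
      moreover have "\<bar>Y (X k) j - Y x j\<bar> \<le> ?n"
        unfolding N_def using j by (intro member_le_sum) auto
      ultimately show ?thesis by linarith
    qed
    then have "(\<lambda>k. Y (X k) j - Y x j) \<longlonglongrightarrow> 0"
      by (intro Lim_null_comparison[OF _ lim]) (auto intro: always_eventually)
    then show ?thesis by (simp add: LIM_zero_iff)
  qed
  have "\<exists>x\<in>l1_sphere r. \<forall>i<r. H x (Y x) i = 0"
  proof (rule borsuk_ulam_l1)
    show "H (\<lambda>j. - x j) (Y (\<lambda>j. - x j)) i = - H x (Y x) i" for x i
      by (simp add: H_def Y_even phase_uminus)
    fix X x i assume X: "\<And>k. X k \<in> l1_sphere r" "x \<in> l1_sphere r" "\<And>j. (\<lambda>k. X k j) \<longlonglongrightarrow> x j" and i: "i < r"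
    have "(\<lambda>k. poly (Q (Y (X k))) t) \<longlonglongrightarrow> poly (Q (Y x)) t" for t
      unfolding Q_def poly_sum poly_smult by (intro tendsto_intros Y_tendsto X) auto
    then show "(\<lambda>k. H (X k) (Y (X k)) i) \<longlonglongrightarrow> H x (Y x) i"
      unfolding H_def by (intro phase_integral_tendsto \<delta> X(3) R i continuous_intros) auto
  qed
  then obtain x where x: "x \<in> l1_sphere r" "\<And>i. i < r \<Longrightarrow> H x (Y x) i = 0" by blast
  have gx: "N (Y x) \<le> \<eta>" "\<And>i. i < r \<Longrightarrow> G x (Y x) i = 0" using Y[OF x(1)] by (auto simp: good_def)
  show ?thesis
  proof (rule that[OF \<delta>(1,2) x(1)])
    show "\<bar>poly (Q (Y x)) t\<bar> \<le> 1 / 2" if "t \<in> {0..1}" for t using Q_le[OF that gx(1)] \<kappa>' by simp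
    show "\<bar>poly (pderiv (Q (Y x))) t\<bar> \<le> 1" if "t \<in> {0..1}" for t using Q'_le[OF that gx(1)] \<kappa>' by simp
  qed (use x(2) gx(2) in \<open>auto simp: G_def H_def\<close>)
qed

section \<open>Reduction to independent functions\<close>

text \<open>
  Only \<open>r\<close> of the functions are independent as functionals on polynomials. By Weierstrass'
  approximation theorem a linear relation between these functionals persists for all continuous
  functions, in particular for the sine and the cosine of the phase.
\<close>
lemma annihilating_phase:
  fixes P :: "nat \<Rightarrow> real \<Rightarrow> real"
  assumes P: "\<And>i. i < m \<Longrightarrow> integrable lebesgue (P i)" "\<And>i t. i < m \<Longrightarrow> t \<notin> {0..1} \<Longrightarrow> P i t = 0"
  obtains r x \<delta> p where "r \<le> m" "0 < \<delta>" "\<delta> \<le> 1 / 2" "x \<in> l1_sphere r"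
    "\<And>t. t \<in> {0..1} \<Longrightarrow> \<bar>poly p t\<bar> \<le> 1 / 2" "\<And>t. t \<in> {0..1} \<Longrightarrow> \<bar>poly (pderiv p) t\<bar> \<le> 1"
    "\<And>i. i < m \<Longrightarrow> (LINT t|lebesgue. P i t * cos (phase \<delta> r x p t)) = 0"
    "\<And>i. i < m \<Longrightarrow> (LINT t|lebesgue. P i t * sin (phase \<delta> r x p t)) = 0"
proof -
  define L where "L k p = (LINT t|lebesgue. P k t * poly p t)" for k p
  have int: "integrable lebesgue (\<lambda>t. P k t * h t)" if "k < m" "continuous_on UNIV h" for k h
    using integrable_mult_continuous[of "P k" h] P that by blast
  have int_poly: "integrable lebesgue (\<lambda>t. P k t * poly p t)" if "k < m" for k p
    by (rule int[OF that]) (intro continuous_intros)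
  have "\<exists>r idx q A. r \<le> m \<and> (\<forall>i<r. idx i < m) \<and>
    (\<forall>i<r. \<forall>j<r. L (idx i) (q j) = of_bool (i = j)) \<and>
    (\<forall>k<m. \<forall>p. L k p = (\<Sum>i<r. A k i * L (idx i) p))"
  proof (rule dual_basis)
    show "L k (p + p') = L k p + L k p'" if "k < m" for k p p'
      by (simp add: L_def distrib_left Bochner_Integration.integral_add int_poly that)
    show "L k (smult c p) = c * L k p" if "k < m" for k c p
      by (simp add: L_def mult.left_commute)
  qed
  then obtain r idx q A where r: "r \<le> m" "\<And>i. i < r \<Longrightarrow> idx i < m"
    and dual: "\<And>i j. i < r \<Longrightarrow> j < r \<Longrightarrow> L (idx i) (q j) = of_bool (i = j)"
    and span: "\<And>k p. k < m \<Longrightarrow> L k p = (\<Sum>i<r. A k i * L (idx i) p)"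
    by blast
  obtain x \<delta> p where x: "0 < \<delta>" "\<delta> \<le> 1 / 2" "x \<in> l1_sphere r"
    "\<And>t. t \<in> {0..1} \<Longrightarrow> \<bar>poly p t\<bar> \<le> 1 / 2" "\<And>t. t \<in> {0..1} \<Longrightarrow> \<bar>poly (pderiv p) t\<bar> \<le> 1"
    and kill: "\<And>i. i < r \<Longrightarrow> (LINT t|lebesgue. P (idx i) t * cos (phase \<delta> r x p t)) = 0"
    "\<And>i. i < r \<Longrightarrow> (LINT t|lebesgue. P (idx i) t * sin (phase \<delta> r x p t)) = 0"
  proof (rule annihilating_phase_independent[of r "\<lambda>i. P (idx i)" q])
    show "(LINT t|lebesgue. P (idx i) t * poly (q j) t) = of_bool (i = j)" if "i < r" "j < r" for i j
      using dual[OF that] by (simp add: L_def)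
  qed (use P r(2) in blast)+
  have zero: "(LINT t|lebesgue. P k t * h t) = 0"
    if k: "k < m" and h: "continuous_on UNIV h" "\<And>i. i < r \<Longrightarrow> (LINT t|lebesgue. P (idx i) t * h t) = 0" for k h
  proof -
    define D where "D t = P k t - (\<Sum>i<r. A k i * P (idx i) t)" for t
    have D_h: "(LINT t|lebesgue. D t * g t) = (LINT t|lebesgue. P k t * g t) - (\<Sum>i<r. A k i * (LINT t|lebesgue. P (idx i) t * g t))"
      if g: "continuous_on UNIV g" for g
    proof -
      have i: "integrable lebesgue (\<lambda>t. A k i * (P (idx i) t * g t))" if "i < r" for i
        using int[OF r(2)[OF that] g] by simp
      have "(LINT t|lebesgue. D t * g t) = (LINT t|lebesgue. P k t * g t - (\<Sum>i<r. A k i * (P (idx i) t * g t)))"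
        by (simp add: D_def left_diff_distrib sum_distrib_right mult.assoc)
      also have "\<dots> = (LINT t|lebesgue. P k t * g t) - (LINT t|lebesgue. (\<Sum>i<r. A k i * (P (idx i) t * g t)))"
        by (intro Bochner_Integration.integral_diff int k g Bochner_Integration.integrable_sum i) auto
      also have "(LINT t|lebesgue. (\<Sum>i<r. A k i * (P (idx i) t * g t))) = (\<Sum>i<r. (LINT t|lebesgue. A k i * (P (idx i) t * g t)))"
        by (intro Bochner_Integration.integral_sum i) auto
      finally show ?thesis by simp
    qed
    have "(LINT t|lebesgue. D t * h t) = 0"
    proof (rule orthogonal_continuous_if_orthogonal_poly[OF _ _ _ h(1)])
      show "integrable lebesgue D" unfolding D_def
        using P(1) r(2) k by (intro Bochner_Integration.integrable_diff Bochner_Integration.integrable_sum) auto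
      show "D t = 0" if "t \<notin> {0..1}" for t using P(2) r(2) k that by (simp add: D_def)
      show "(LINT t|lebesgue. D t * poly p t) = 0" for p
        using D_h[of "poly p"] span[OF k, of p] by (simp add: L_def continuous_intros)
    qed
    then show ?thesis using D_h[OF h(1)] h(2) by simp
  qed
  show ?thesis
    by (rule that[OF r(1) x]) (auto intro!: zero kill continuous_intros continuous_phase)
qed

section \<open>The bound on the derivative\<close>

text \<open>
  Each of the \<open>r + 1\<close> pieces rises by 1 and falls by 1, so the total variation of the wave is at most
  \<open>2 * (r + 1)\<close>. It is expressed by a majorant \<open>V'\<close> of the derivative with primitive \<open>V\<close>: the primitive
  adds the rises and the falls of all pieces instead of subtracting them.
\<close>
lemma wave_variation:
  assumes "0 < \<delta>"
  obtains \<sigma>' V V' where "\<And>t. (wave \<delta> r x has_real_derivative \<sigma>' t) (at t)"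
    "\<And>t. (V has_real_derivative V' t) (at t)" "continuous_on UNIV V'"
    "\<And>t. \<bar>\<sigma>' t\<bar> \<le> V' t" "V 1 - V 0 \<le> 2 * (real r + 1)"
proof -
  define s' where "s' = deriv smooth_step"
  have s: "(smooth_step has_real_derivative s' t) (at t)" for t
    using times_differentiable_smooth_step[of 1] by (simp add: s'_def)
  have "s' t \<ge> 0" for t
    by (rule mono_on_imp_deriv_nonneg[OF mono_smooth_step s]) simp
  have s'_cont: "continuous_on UNIV s'"
    using times_differentiable_smooth_step[of 2] unfolding s'_def
    by (auto simp: numeral_2_eq_2 intro!: continuous_at_imp_continuous_on DERIV_isCont)
  define up where "up j t = smooth_step (((t - breakpoint x j) / \<bar>x j\<bar> - 0) / \<delta>)" for j t
  define dn where "dn j t = smooth_step (((t - breakpoint x j) / \<bar>x j\<bar> - (1 - \<delta>)) / \<delta>)" for j t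
  define up' where "up' j t = 1 / \<bar>x j\<bar> * (1 / \<delta> * s' (((t - breakpoint x j) / \<bar>x j\<bar> - 0) / \<delta>))" for j t
  define dn' where "dn' j t = 1 / \<bar>x j\<bar> * (1 / \<delta> * s' (((t - breakpoint x j) / \<bar>x j\<bar> - (1 - \<delta>)) / \<delta>))" for j t
  have der: "(up j has_real_derivative up' j t) (at t)" "(dn j has_real_derivative dn' j t) (at t)" for j t
    unfolding up_def[abs_def] up'_def dn_def[abs_def] dn'_def
    by (intro DERIV_affine_compose[where f = "\<lambda>u. smooth_step ((u - _) / \<delta>)"] DERIV_affine_compose[where f = smooth_step] s)+
  have nonneg: "0 \<le> up' j t" "0 \<le> dn' j t" for j t
    using \<open>\<And>t. s' t \<ge> 0\<close> assms by (auto simp: up'_def dn'_def)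
  have cont: "continuous_on UNIV (up' j)" "continuous_on UNIV (dn' j)" for j
  proof -
    have c: "continuous_on UNIV (\<lambda>t. s' (((t - breakpoint x j) / \<bar>x j\<bar> - a) / \<delta>))" for a
    proof (rule continuous_on_compose2[OF s'_cont])
      show "continuous_on UNIV (\<lambda>t. ((t - breakpoint x j) / \<bar>x j\<bar> - a) / \<delta>)"
        using assms by (cases "x j = 0") (auto intro!: continuous_intros)
    qed simp
    show "continuous_on UNIV (up' j)" "continuous_on UNIV (dn' j)"
      unfolding up'_def[abs_def] dn'_def[abs_def] by (intro continuous_on_mult continuous_on_const c)+
  qed
  show ?thesis
  proof
    have wave: "wave \<delta> r x = (\<lambda>t. \<Sum>j\<le>r. sgn (x j) * (up j t - dn j t))"
      by (simp add: wave_def[abs_def] bump_def up_def dn_def)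
    show "(wave \<delta> r x has_real_derivative (\<Sum>j\<le>r. sgn (x j) * (up' j t - dn' j t))) (at t)" for t
      unfolding wave by (intro DERIV_sum DERIV_cmult DERIV_diff der)
    show "((\<lambda>t. \<Sum>j\<le>r. up j t + dn j t) has_real_derivative (\<Sum>j\<le>r. up' j t + dn' j t)) (at t)" for t
      by (intro DERIV_sum DERIV_add der)
    show "continuous_on UNIV (\<lambda>t. \<Sum>j\<le>r. up' j t + dn' j t)"
      by (intro continuous_intros cont)
    show "\<bar>\<Sum>j\<le>r. sgn (x j) * (up' j t - dn' j t)\<bar> \<le> (\<Sum>j\<le>r. up' j t + dn' j t)" for t
    proof (rule order_trans[OF sum_abs sum_mono])
      fix j
      have "\<bar>up' j t - dn' j t\<bar> \<le> up' j t + dn' j t" using nonneg[of j t] by linarith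
      then show "\<bar>sgn (x j) * (up' j t - dn' j t)\<bar> \<le> up' j t + dn' j t"
        using nonneg[of j t] by (auto simp: abs_mult abs_sgn_eq)
    qed
    have "(\<Sum>j\<le>r. up j 1 + dn j 1) - (\<Sum>j\<le>r. up j 0 + dn j 0) = (\<Sum>j\<le>r. (up j 1 + dn j 1) - (up j 0 + dn j 0))"
      by (simp add: sum_subtractf)
    also have "\<dots> \<le> (\<Sum>j\<le>r. 2)"
    proof (rule sum_mono)
      show "(up j 1 + dn j 1) - (up j 0 + dn j 0) \<le> 2" for j
        unfolding up_def dn_def
        using smooth_step_bounds(2)[of "((1 - breakpoint x j) / \<bar>x j\<bar> - 0) / \<delta>"]
          smooth_step_bounds(2)[of "((1 - breakpoint x j) / \<bar>x j\<bar> - (1 - \<delta>)) / \<delta>"]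
          smooth_step_bounds(1)[of "((0 - breakpoint x j) / \<bar>x j\<bar> - 0) / \<delta>"]
          smooth_step_bounds(1)[of "((0 - breakpoint x j) / \<bar>x j\<bar> - (1 - \<delta>)) / \<delta>"] by linarith
    qed
    finally show "(\<Sum>j\<le>r. up j 1 + dn j 1) - (\<Sum>j\<le>r. up j 0 + dn j 0) \<le> 2 * (real r + 1)" by simp
  qed
qed

lemma W11_norm_cis_le:
  assumes \<theta>: "\<And>t. (\<theta> has_real_derivative \<theta>' t) (at t)" "continuous_on UNIV \<theta>'"
    and g: "\<And>t. (g has_real_derivative g' t) (at t)" "continuous_on UNIV g'"
    and le: "\<And>t. t \<in> {0..1} \<Longrightarrow> \<bar>\<theta>' t\<bar> \<le> g' t"
  shows "W11_norm (\<lambda>t. exp (\<i> * complex_of_real (\<theta> t))) \<le> 1 + (g 1 - g 0)"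
proof -
  have one: "(LINT t:{0..1::real}|lebesgue. norm (exp (\<i> * complex_of_real (\<theta> t)))) = 1"
    by (simp add: set_lebesgue_integral_def)
  have vd: "vector_derivative (\<lambda>t. exp (\<i> * complex_of_real (\<theta> t))) (at t within {0..1})
      = \<i> * complex_of_real (\<theta>' t) * exp (\<i> * complex_of_real (\<theta> t))" if t: "t \<in> {0..1}" for t
  proof (rule vector_derivative_within_closed_interval)
    have "((\<lambda>t. complex_of_real (\<theta> t)) has_vector_derivative complex_of_real (\<theta>' t)) (at t within {0..1})"
      using \<theta>(1)[of t] by (intro has_vector_derivative_of_real) (rule has_field_derivative_at_within)
    then have "((\<lambda>t. \<i> * complex_of_real (\<theta> t)) has_vector_derivative \<i> * complex_of_real (\<theta>' t)) (at t within {0..1})"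
      by (rule has_vector_derivative_mult_right)
    from field_vector_diff_chain_within[OF this, of exp "exp (\<i> * complex_of_real (\<theta> t))"]
    show "((\<lambda>t. exp (\<i> * complex_of_real (\<theta> t))) has_vector_derivative
       \<i> * complex_of_real (\<theta>' t) * exp (\<i> * complex_of_real (\<theta> t))) (at t within {0..1})"
      by (simp add: o_def has_field_derivative_at_within[OF DERIV_exp])
  qed (use t in auto)
  have "(LINT t:{0..1}|lebesgue. norm (vector_derivative (\<lambda>t. exp (\<i> * complex_of_real (\<theta> t))) (at t within {0..1})))
      = (LINT t:{0..1}|lebesgue. \<bar>\<theta>' t\<bar>)"
    by (rule set_lebesgue_integral_cong) (auto simp: vd norm_mult)
  also have "\<dots> \<le> (LINT t:{0..1}|lebesgue. g' t)"
  proof (rule set_integral_mono)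
    show "set_integrable lebesgue {0..1} (\<lambda>t. \<bar>\<theta>' t\<bar>)" "set_integrable lebesgue {0..1} g'"
      using \<theta>(2) g(2) by (auto intro!: absolutely_integrable_continuous_real continuous_intros intro: continuous_on_subset)
  qed (rule le)
  also have "\<dots> = integral {0..1} g'"
    by (rule set_lebesgue_integral_eq_integral(2))
       (use g(2) in \<open>auto intro!: absolutely_integrable_continuous_real intro: continuous_on_subset\<close>)
  also have "\<dots> = g 1 - g 0"
    by (intro integral_unique fundamental_theorem_of_calculus)
       (auto simp: has_real_derivative_iff_has_vector_derivative[symmetric] intro!: has_field_derivative_at_within[OF g(1)])
  finally show ?thesis unfolding W11_norm_def one by simp
qed


section \<open>The theorem\<close>

theorem corollary4:
  fixes n :: nat and f :: "nat \<Rightarrow> real \<Rightarrow> complex"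
  assumes "n \<ge> 1"
    and "\<And>k. k \<in> {1..n} \<Longrightarrow> f k absolutely_integrable_on {0..1}"
  shows "\<exists>\<theta> :: real \<Rightarrow> real.
           smooth_on {0..1} \<theta> \<and>
           (\<forall>k\<in>{1..n}. (LINT t:{0..1}|lebesgue. f k t * exp (\<i> * complex_of_real (\<theta> t))) = 0) \<and>
           W11_norm (\<lambda>t. exp (\<i> * complex_of_real (\<theta> t))) \<le> 5 * pi * real n + 1"
proof -
  define F where "F k t = indicat_real {0..1} t *\<^sub>R f k t" for k t
  \<comment> \<open>the \<open>2 * n\<close> real and imaginary parts, alternately\<close>
  define P where "P i t = (if even i then Re (F (Suc (i div 2)) t) else Im (F (Suc (i div 2)) t))" for i t
  have F: "integrable lebesgue (F k)" if "k \<in> {1..n}" for k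
    using assms(2)[OF that] by (simp add: set_integrable_def F_def[abs_def])
  have P_int: "integrable lebesgue (P i)" if "i < 2 * n" for i
  proof -
    have "integrable lebesgue (F (Suc (i div 2)))" using that by (intro F) auto
    then show ?thesis unfolding P_def[abs_def] by (cases "even i") auto
  qed
  have P_0: "P i t = 0" if "t \<notin> {0..1}" for i t using that by (simp add: P_def F_def)
  obtain r x \<delta> p where r: "r \<le> 2 * n" and \<delta>: "0 < \<delta>" "\<delta> \<le> 1 / 2" and x: "x \<in> l1_sphere r"
    and p: "\<And>t. t \<in> {0..1} \<Longrightarrow> \<bar>poly p t\<bar> \<le> 1 / 2" "\<And>t. t \<in> {0..1} \<Longrightarrow> \<bar>poly (pderiv p) t\<bar> \<le> 1"
    and kill: "\<And>i. i < 2 * n \<Longrightarrow> (LINT t|lebesgue. P i t * cos (phase \<delta> r x p t)) = 0"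
    "\<And>i. i < 2 * n \<Longrightarrow> (LINT t|lebesgue. P i t * sin (phase \<delta> r x p t)) = 0"
  proof (rule annihilating_phase[of "2 * n" P])
  qed (use P_int P_0 in blast)+
  define \<theta> where "\<theta> t = pi / 2 + - 1 * (wave \<delta> r x t * (pi / 2 + - 1 * poly p t))" for t
  have \<theta>_phase: "\<theta> t = pi / 2 - phase \<delta> r x p t" for t by (simp add: \<theta>_def phase_def)
  have \<theta>_smooth: "times_differentiable k \<theta>" for k unfolding \<theta>_def[abs_def]
    by (intro times_differentiable_add times_differentiable_mult times_differentiable_const
        times_differentiable_wave times_differentiable_poly)
  have exp_\<theta>: "exp (\<i> * complex_of_real (\<theta> t)) = Complex (sin (phase \<delta> r x p t)) (cos (phase \<delta> r x p t))" for t
    unfolding cis_conv_exp[symmetric] by (simp add: \<theta>_phase complex_eq_iff cos_diff sin_diff)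
  have zero: "(LINT t:{0..1}|lebesgue. f k t * exp (\<i> * complex_of_real (\<theta> t))) = 0" if k: "k \<in> {1..n}" for k
  proof -
    define i where "i = 2 * (k - 1)"
    have i: "i < 2 * n" "Suc i < 2 * n" "P i t = Re (F k t)" "P (Suc i) t = Im (F k t)" for t
      using k by (auto simp: i_def P_def)
    let ?s = "\<lambda>t. sin (phase \<delta> r x p t)" and ?c = "\<lambda>t. cos (phase \<delta> r x p t)"
    let ?h = "\<lambda>t. F k t * Complex (?s t) (?c t)"
    have eq: "(LINT t:{0..1}|lebesgue. f k t * exp (\<i> * complex_of_real (\<theta> t))) = (LINT t|lebesgue. ?h t)"
      by (simp add: set_lebesgue_integral_def F_def exp_\<theta>)
    have int: "integrable lebesgue (\<lambda>t. P j t * h t)" if "j < 2 * n" "continuous_on UNIV h" for j h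
      using integrable_mult_continuous[of "P j" h] P_int P_0 that by blast
    have cont: "continuous_on UNIV ?s" "continuous_on UNIV ?c" by (intro continuous_intros continuous_phase)+
    show ?thesis
    proof (cases "integrable lebesgue ?h")
      case False
      then show ?thesis unfolding eq by (rule not_integrable_integral_eq)
    next
      case True
      have "Re (LINT t|lebesgue. ?h t) = (LINT t|lebesgue. Re (?h t))"
        by (rule integral_Re[OF True, symmetric])
      also have "\<dots> = (LINT t|lebesgue. P i t * ?s t - P (Suc i) t * ?c t)" by (simp add: i)
      also have "\<dots> = (LINT t|lebesgue. P i t * ?s t) - (LINT t|lebesgue. P (Suc i) t * ?c t)"
        by (intro Bochner_Integration.integral_diff int i cont)
      also have "\<dots> = 0" unfolding kill(2)[OF i(1)] kill(1)[OF i(2)] by simp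
      finally have re: "Re (LINT t|lebesgue. ?h t) = 0" .
      have "Im (LINT t|lebesgue. ?h t) = (LINT t|lebesgue. Im (?h t))"
        by (rule integral_Im[OF True, symmetric])
      also have "\<dots> = (LINT t|lebesgue. P i t * ?c t + P (Suc i) t * ?s t)" by (simp add: i)
      also have "\<dots> = (LINT t|lebesgue. P i t * ?c t) + (LINT t|lebesgue. P (Suc i) t * ?s t)"
        by (intro Bochner_Integration.integral_add int i cont)
      also have "\<dots> = 0" unfolding kill(1)[OF i(1)] kill(2)[OF i(2)] by simp
      finally have "Im (LINT t|lebesgue. ?h t) = 0" .
      then show ?thesis unfolding eq using re by (simp add: complex_eq_iff)
    qed
  qed
  obtain \<sigma>' V V' where V: "\<And>t. (wave \<delta> r x has_real_derivative \<sigma>' t) (at t)"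
    "\<And>t. (V has_real_derivative V' t) (at t)" "continuous_on UNIV V'"
    "\<And>t. \<bar>\<sigma>' t\<bar> \<le> V' t" "V 1 - V 0 \<le> 2 * (real r + 1)"
    using wave_variation[OF \<delta>(1), of r x] by blast
  \<comment> \<open>a bound for the factor \<open>pi / 2 - poly p t\<close> of the wave\<close>
  define C where "C = pi / 2 + 1 / 2"
  have C: "C > 0" unfolding C_def using pi_gt_zero by linarith
  have \<theta>': "(\<theta> has_real_derivative deriv \<theta> t) (at t)" for t using \<theta>_smooth[of 1] by simp
  have deriv_\<theta>: "deriv \<theta> t = wave \<delta> r x t * poly (pderiv p) t - \<sigma>' t * (pi / 2 - poly p t)" for t
  proof (rule DERIV_imp_deriv)
    show "(\<theta> has_real_derivative wave \<delta> r x t * poly (pderiv p) t - \<sigma>' t * (pi / 2 - poly p t)) (at t)"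
      unfolding \<theta>_def[abs_def] by (auto intro!: derivative_eq_intros V(1) poly_DERIV simp: algebra_simps)
  qed
  have "W11_norm (\<lambda>t. exp (\<i> * complex_of_real (\<theta> t))) \<le> 1 + ((C * V 1 + 1) - (C * V 0 + 0))"
  proof (rule W11_norm_cis_le[where g = "\<lambda>t. C * V t + t" and g' = "\<lambda>t. C * V' t + 1", OF \<theta>'])
    show "continuous_on UNIV (deriv \<theta>)"
      using \<theta>_smooth[of 2] by (auto simp: numeral_2_eq_2 intro!: continuous_at_imp_continuous_on DERIV_isCont)
    show "((\<lambda>t. C * V t + t) has_real_derivative C * V' t + 1) (at t)" for t
      by (intro DERIV_add DERIV_cmult V(2) DERIV_ident)
    show "continuous_on UNIV (\<lambda>t. C * V' t + 1)" by (intro continuous_intros V(3))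
    fix t :: real assume t: "t \<in> {0..1}"
    have "\<bar>wave \<delta> r x t * poly (pderiv p) t\<bar> \<le> 1 * 1"
      unfolding abs_mult by (intro mult_mono abs_wave_le_1 \<delta> p(2) t) auto
    moreover have "\<bar>\<sigma>' t * (pi / 2 - poly p t)\<bar> \<le> V' t * C"
      unfolding abs_mult
    proof (intro mult_mono V(4))
      show "\<bar>pi / 2 - poly p t\<bar> \<le> C" using p(1)[OF t] pi_gt_zero unfolding C_def by linarith
      show "0 \<le> V' t" using V(4)[of t] by linarith
    qed auto
    ultimately show "\<bar>deriv \<theta> t\<bar> \<le> C * V' t + 1"
      unfolding deriv_\<theta> mult.commute[of C] by linarith
  qed
  also have "\<dots> = 2 + C * (V 1 - V 0)" by (simp add: algebra_simps)
  also have "\<dots> \<le> 2 + C * (2 * (2 * real n + 1))"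
    using V(5) r C by (intro add_left_mono mult_left_mono) auto
  also have "\<dots> = 2 * (pi * real n) + pi + 2 * real n + 3" by (simp add: C_def algebra_simps)
  also have "\<dots> \<le> 5 * pi * real n + 1"
  proof -
    have "pi * 1 \<le> pi * real n" using assms(1) pi_gt_zero by (intro mult_left_mono) auto
    moreover have "2 * real n \<le> pi * real n" using pi_gt3 by (intro mult_right_mono) auto
    moreover have "pi > 2" using pi_gt3 by simp
    ultimately show ?thesis unfolding mult.assoc by linarith
  qed
  finally show ?thesis using zero smooth_on_if_times_differentiable[OF \<theta>_smooth] by blast
qed

end
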